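(* Let $\mathbb K$ be an algebraically closed field of characteristic zero, let $A=(a,b)\in\mathbb K^2$ and $d,d'\in\mathbb K\setminus\{0\}$, and let $\mathcal C\subset\mathbb K^2$ be an irreducible affine plane algebraic curve which is neither of the two lines $y_1\pm\sqrt{-1}\,y_2=0$, is neither of the circles $(y_1-a)^2+(y_2-b)^2=d^2$ and $(y_1-a)^2+(y_2-b)^2=d'^2$, and is not a line through $A$. Denote by $\mathfrak C(\mathcal C,A,\delta)$ the conchoid of $\mathcal C$ from the focus $A$ and distance $\delta$. Then: (1) If all the components of $\mathfrak C(\mathcal C,A,d)$ are rational, then $\mathcal C$ is rational. (2) All the components of $\mathfrak C(\mathcal C,A,d)$ are rational if and only if all the components of $\mathfrak C(\mathcal C,A,d')$ are rational.
   Context: Let $f$ be the irreducible defining polynomial of $\mathcal C$. For $P=(P_1,P_2)$ write $\|P\|^2=P_1^2+P_2^2$ (no conjugation). For $\delta\in\mathbb K\setminus\{0\}$, the conchoid $\mathfrak C(\mathcal C,A,\delta)$ is the Zariski closure in $\mathbb K^2$ of the set of points $\bar x\in\mathbb K^2$ for which there exist $\bar y\in\mathbb K^2$ and $\lambda\in\mathbb K$ with $f(\bar y)=0$, $\|\bar x-\bar y\|^2=\delta^2$ and $\bar x=A+\lambda(\bar y-A)$. A (rational) parametrization of an irreducible plane curve is a pair of rational functions in $\mathbb K(t)^2$, not both constant, whose values are Zariski dense in the curve; a curve is rational if it is irreducible and has a parametrization. Components of a plane curve are its irreducible components over $\mathbb K$. *)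

theory Defs
  imports "HOL-Computational_Algebra.Computational_Algebra" "HOL-Library.Product_Plus"
begin

(* A bivariate polynomial is an element of K[y1][y2]: the outer variable is the second coordinate. *)
definition eval2 :: "'a::comm_ring_1 poly poly \<Rightarrow> 'a \<times> 'a \<Rightarrow> 'a" where
  "eval2 f P = poly (poly f [:snd P:]) (fst P)"

definition zero_locus :: "'a::comm_ring_1 poly poly set \<Rightarrow> ('a \<times> 'a) set" where
  "zero_locus F = {P. \<forall>f\<in>F. eval2 f P = 0}"

definition algebraic_set :: "('a::comm_ring_1 \<times> 'a) set \<Rightarrow> bool" where
  "algebraic_set V \<longleftrightarrow> (\<exists>F. V = zero_locus F)"

definition zariski_closure :: "('a::comm_ring_1 \<times> 'a) set \<Rightarrow> ('a \<times> 'a) set" where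
  "zariski_closure S = \<Inter>{V. algebraic_set V \<and> S \<subseteq> V}"

definition irreducible_algebraic_set :: "('a::comm_ring_1 \<times> 'a) set \<Rightarrow> bool" where
  "irreducible_algebraic_set V \<longleftrightarrow> algebraic_set V \<and> V \<noteq> {} \<and>
     (\<forall>V1 V2. algebraic_set V1 \<longrightarrow> algebraic_set V2 \<longrightarrow> V = V1 \<union> V2 \<longrightarrow> V = V1 \<or> V = V2)"

definition components :: "('a::comm_ring_1 \<times> 'a) set \<Rightarrow> ('a \<times> 'a) set set" where
  "components Z = {V. irreducible_algebraic_set V \<and> V \<subseteq> Z \<and>
     (\<forall>W. irreducible_algebraic_set W \<longrightarrow> V \<subseteq> W \<longrightarrow> W \<subseteq> Z \<longrightarrow> W = V)}"

definition irreducible_plane_curve :: "('a::field \<times> 'a) set \<Rightarrow> bool" where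
  "irreducible_plane_curve C \<longleftrightarrow> (\<exists>f. irreducible f \<and> C = zero_locus {f})"

definition affine_line :: "('a::field \<times> 'a) set \<Rightarrow> bool" where
  "affine_line L \<longleftrightarrow>
     (\<exists>\<alpha> \<beta> \<gamma>. (\<alpha>, \<beta>) \<noteq> (0, 0) \<and> L = {(y1, y2). \<alpha> * y1 + \<beta> * y2 + \<gamma> = 0})"

(* No conjugation: for complex points this is not the Hermitian norm. *)
definition norm_sq :: "'a::comm_ring_1 \<times> 'a \<Rightarrow> 'a" where
  "norm_sq P = (fst P)\<^sup>2 + (snd P)\<^sup>2"

definition circle :: "'a::comm_ring_1 \<times> 'a \<Rightarrow> 'a \<Rightarrow> ('a \<times> 'a) set" where
  "circle A r = {P. norm_sq (P - A) = r\<^sup>2}"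

definition scale :: "'a::comm_ring_1 \<Rightarrow> 'a \<times> 'a \<Rightarrow> 'a \<times> 'a" where
  "scale c P = (c * fst P, c * snd P)"

definition conchoid :: "('a::field \<times> 'a) set \<Rightarrow> 'a \<times> 'a \<Rightarrow> 'a \<Rightarrow> ('a \<times> 'a) set" where
  "conchoid C A \<delta> = zariski_closure
     {x. \<exists>y \<mu>. y \<in> C \<and> norm_sq (x - y) = \<delta>\<^sup>2 \<and> x = A + scale \<mu> (y - A)}"

(* The rational function r is defined at t, with value v there.  The fraction p / q need not
   be in lowest terms, but where two such fractions for r are both defined their values agree. *)
definition ratfun_value :: "'a::field poly fract \<Rightarrow> 'a \<Rightarrow> 'a \<Rightarrow> bool" where
  "ratfun_value r t v \<longleftrightarrow>
     (\<exists>p q. r = Fract p q \<and> poly q t \<noteq> 0 \<and> v = poly p t / poly q t)"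

definition constant_ratfun :: "'a::field poly fract \<Rightarrow> bool" where
  "constant_ratfun r \<longleftrightarrow> (\<exists>c. r = Fract [:c:] 1)"

definition is_parametrization ::
    "('a::field \<times> 'a) set \<Rightarrow> 'a poly fract \<Rightarrow> 'a poly fract \<Rightarrow> bool" where
  "is_parametrization C r s \<longleftrightarrow> \<not> (constant_ratfun r \<and> constant_ratfun s) \<and>
     zariski_closure {(u, v). \<exists>t. ratfun_value r t u \<and> ratfun_value s t v} = C"

definition rational_curve :: "('a::field \<times> 'a) set \<Rightarrow> bool" where
  "rational_curve C \<longleftrightarrow> irreducible_plane_curve C \<and> (\<exists>r s. is_parametrization C r s)"

end

theory Submission
  imports Defs
begin

text \<open>
  Write a point of \<open>C\<close> as \<open>y = A + r e\<close> with \<open>e\<close> a unit vector for the quadratic form \<open>norm_sq\<close>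
  and \<open>r\<^sup>2 = norm_sq (y - A) \<noteq> 0\<close>; the pair \<open>(r, e)\<close> is determined up to a common sign. The
  points of the conchoid are the points \<open>A + (r + \<delta>) e\<close>. They are the images of the double cover
  \<open>B = {(y, r). y \<in> C, r\<^sup>2 = norm_sq (y - A) \<noteq> 0}\<close> of \<open>C\<close>, and \<open>B\<close> does not depend on the
  distance. The theorem says that rationality can be read off from \<open>B\<close>: for each \<open>\<delta> \<noteq> 0\<close> such
  that \<open>C\<close> is not the circle of radius \<open>\<delta>\<close>, all components of the conchoid are rational if and
  only if there is a nonconstant rational map \<open>\<gamma>\<close> into \<open>C\<close> together with a rational function \<open>\<rho>\<close>
  such that \<open>\<rho>\<^sup>2 = norm_sq (\<gamma> - A)\<close> (\<open>square_distance_map\<close>). This condition makes \<open>C\<close> rational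
  and does not mention \<open>\<delta>\<close>, so both claims follow.

  From \<open>B\<close> to the conchoid: the two maps \<open>\<gamma> + (\<delta> / \<plusminus>\<rho>)(\<gamma> - A)\<close> parametrize components, and they
  reach everything, because a polynomial that vanishes at both conchoid points over infinitely
  many points of \<open>C\<close> vanishes on the whole conchoid (\<open>vanishes_on_conchoid_points\<close>).

  From the conchoid to \<open>B\<close>: given \<open>z = A + w e\<close> on the conchoid, the point of \<open>C\<close> is
  \<open>A + (w - \<delta>) e\<close>, so it suffices to express \<open>w\<close> rationally in \<open>z\<close>. Clearing denominators in
  \<open>f (A + (w - \<delta>) e) = 0\<close> and reducing by \<open>w\<^sup>2 = norm_sq (z - A)\<close> gives an equation
  \<open>U z + w V z = 0\<close>, which determines \<open>w\<close> on every component on which \<open>V\<close> does not vanish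
  identically (\<open>square_distance_map_from_component\<close>). Such a component exists: otherwise \<open>U\<close> and
  \<open>V\<close> vanish on the whole conchoid, the equation also holds for \<open>-w\<close>, and so each point
  \<open>A + r e\<close> of \<open>C\<close> yields the further point \<open>A + (r + 2\<delta>) e\<close>; iterating, \<open>C\<close> would have
  infinitely many points on one line through \<open>A\<close> (\<open>conchoid_sheet_distinguished\<close>).

  The algebraic geometry behind this is elementary: distinct irreducible plane curves meet in
  finitely many points (\<open>finite_common_zeros\<close>), and the conchoid is a finite union of curves
  without isolated points (\<open>components_conchoid\<close>).
\<close>

section \<open>Plane curves and bivariate polynomials\<close>

lemma eval2_pCons: "eval2 (pCons p f) P = poly p (fst P) + snd P * eval2 f P"
  by (simp add: eval2_def)

lemma eval2_simps [simp]:
  "eval2 0 P = 0" "eval2 1 P = 1"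
  "eval2 (f + g) P = eval2 f P + eval2 g P"
  "eval2 (f - g) P = eval2 f P - eval2 g P"
  "eval2 (- f) P = - eval2 f P"
  "eval2 (f * g) P = eval2 f P * eval2 g P"
  "eval2 (f ^ n) P = eval2 f P ^ n"
  "eval2 [:p:] P = poly p (fst P)"
  "eval2 [:0, 1:] P = snd P"
  by (simp_all add: eval2_def poly_power)

lemma in_zero_locus [simp]: "P \<in> zero_locus {f} \<longleftrightarrow> eval2 f P = 0"
  by (simp add: zero_locus_def)

text \<open>
  Polynomial functions form the algebra generated by the constants and the two coordinates.
  Claims that values after a substitution have some normal form are closed under sums and
  products, which makes this rule the convenient way to clear denominators.
\<close>
lemma eval2_induct [case_names const fst snd add mult]:
  assumes const: "\<And>c. Q (\<lambda>P. c)" and fst: "Q fst" and snd: "Q snd"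
    and add: "\<And>g h. Q g \<Longrightarrow> Q h \<Longrightarrow> Q (\<lambda>P. g P + h P)"
    and mult: "\<And>g h. Q g \<Longrightarrow> Q h \<Longrightarrow> Q (\<lambda>P. g P * h P)"
  shows "Q (eval2 f)"
proof -
  have "Q (\<lambda>P. poly p (fst P))" for p
  proof (induction p)
    case 0
    show ?case using const[of 0] by simp
  next
    case (pCons a p)
    show ?case using add[OF const[of a] mult[OF fst pCons.IH]] by simp
  qed
  note univariate = this
  show ?thesis
  proof (induction f)
    case 0
    show ?case using const[of 0] by (simp add: eval2_def)
  next
    case (pCons p f)
    show ?case
      using add[OF univariate[of p] mult[OF snd pCons.IH]] by (simp add: eval2_pCons[abs_def])
  qed
qed

definition fibre_poly :: "'a::comm_ring_1 \<Rightarrow> 'a poly poly \<Rightarrow> 'a poly" where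
  "fibre_poly x f = map_poly (\<lambda>p. poly p x) f"

lemma poly_fibre_poly: "poly (fibre_poly x f) y = eval2 f (x, y)"
  by (induction f) (simp_all add: fibre_poly_def map_poly_pCons eval2_pCons)

abbreviation vertical :: "'a::field \<Rightarrow> 'a poly poly" where
  "vertical x \<equiv> [:[:- x, 1:]:]"

lemma fibre_poly_eq_0_iff: "fibre_poly x f = 0 \<longleftrightarrow> vertical x dvd f"
  by (simp add: fibre_poly_def poly_eq_iff coeff_map_poly const_poly_dvd_iff poly_eq_0_iff_dvd)

lemma prime_vertical: "prime_elem (vertical x)"
  by (intro lift_prime_elem_poly prime_elem_linear_field_poly) simp

text \<open>
  Gauss's lemma in the form needed here. Over an algebraically closed field a nonconstant factor
  \<open>c\<close> splits off a linear polynomial, which remains prime as a bivariate polynomial, so the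
  roots of \<open>c\<close> can be cancelled one after the other.
\<close>
lemma dvd_cancel_const_poly:
  fixes f h :: "'a::alg_closed_field poly poly"
  assumes "\<And>x. \<not> vertical x dvd h" and "c \<noteq> 0" and "h dvd [:c:] * f"
  shows "h dvd f"
  using assms(2,3)
proof (induction "degree c" arbitrary: c)
  case 0
  then obtain k where "c = [:k:]" "k \<noteq> 0"
    by (metis degree_eq_zeroE pCons_0_0)
  then have "is_unit [:c:]"
    by (simp add: is_unit_const_poly_iff dvd_field_iff)
  with 0 show ?case
    by (metis dvd_mult_unit_iff mult.commute)
next
  case (Suc n)
  then obtain x where "poly c x = 0"
    by (metis alg_closed_imp_poly_has_root zero_less_Suc)
  then obtain c' where c': "c = [:- x, 1:] * c'"
    by (metis dvdE poly_eq_0_iff_dvd)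
  then have nz: "c' \<noteq> 0" using Suc.prems by auto
  then have deg: "degree c' = n"
    using Suc.hyps(2) c' by (simp add: degree_mult_eq del: mult_pCons_left)
  have split: "[:c:] = vertical x * [:c':]"
    by (simp add: c')
  obtain q where q: "[:c:] * f = h * q"
    using Suc.prems by (auto simp: dvd_def)
  have "vertical x dvd h * q"
    unfolding q[symmetric] split by (metis dvd_triv_left mult.assoc)
  with assms(1) have "vertical x dvd q"
    using prime_vertical prime_elem_dvd_mult_iff by blast
  then obtain q' where "q = vertical x * q'" by (auto simp: dvd_def)
  with q split have "vertical x * ([:c':] * f) = vertical x * (h * q')"
    by (metis mult.assoc mult.left_commute)
  then have "[:c':] * f = h * q'"
    by (subst (asm) mult_cancel_left) simp
  then show ?case
    using Suc.hyps(1)[OF deg[symmetric] nz] by (metis dvd_triv_left)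
qed

lemma vertical_free_part:
  fixes e :: "'a::field poly poly"
  assumes "e \<noteq> 0"
  obtains h k where "e = [:k:] * h" "\<And>x. \<not> vertical x dvd h"
  using assms
proof (induction "degree (lead_coeff e)" arbitrary: e thesis rule: less_induct)
  case less
  show ?case
  proof (cases "\<exists>x. vertical x dvd e")
    case True
    then obtain x e' where e': "e = vertical x * e'" by (auto simp: dvd_def)
    with less.prems have nz: "e' \<noteq> 0" by auto
    have "lead_coeff e = [:- x, 1:] * lead_coeff e'"
      unfolding e' by (simp add: lead_coeff_mult del: mult_pCons_left)
    then have "degree (lead_coeff e') < degree (lead_coeff e)"
      using nz by (simp add: degree_mult_eq del: mult_pCons_left)
    from less.hyps[OF this _ nz] obtain h k where
      "e' = [:k:] * h" "\<And>x. \<not> vertical x dvd h" by blast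
    moreover from this have "e = [:[:- x, 1:] * k:] * h"
      by (simp add: e' ac_simps)
    ultimately show ?thesis using less.prems by blast
  next
    case False
    moreover have "e = [:1:] * e" by simp
    ultimately show ?thesis using less.prems(1) by blast
  qed
qed

text \<open>
  In the ideal generated by \<open>f\<close> and \<open>g\<close>, an element \<open>e\<close> of least degree in the second variable
  pseudo-divides both generators. If that degree were positive, the part of \<open>e\<close> without vertical
  factors would divide \<open>f\<close> and \<open>g\<close>, hence be associated to the irreducible \<open>f\<close>, contrary to the
  assumption.
\<close>
lemma irreducible_Bezout:
  fixes f g :: "'a::alg_closed_field poly poly"
  assumes "irreducible f" and "\<not> f dvd g"
  obtains u v c where "c \<noteq> 0" "u * f + v * g = [:c:]"
proof -
  define J where "J = (\<lambda>e. e \<noteq> 0 \<and> (\<exists>u v. e = u * f + v * g))"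
  have "f = 1 * f + 0 * g" "f \<noteq> 0"
    using assms(1) by auto
  then have "J f" unfolding J_def by blast
  then obtain e where e: "J e" and least: "\<And>e'. J e' \<Longrightarrow> degree e \<le> degree e'"
    using ex_has_least_nat[of J f degree] by blast
  obtain u v where uv: "e = u * f + v * g" and nz: "e \<noteq> 0"
    using e by (auto simp: J_def)
  show ?thesis
  proof (cases "degree e = 0")
    case True
    then show ?thesis using that uv nz by (metis degree_eq_zeroE pCons_0_0)
  next
    case False
    obtain h k where h: "e = [:k:] * h" and free: "\<And>x. \<not> vertical x dvd h"
      using vertical_free_part[OF nz] by blast
    have dvd: "h dvd p" if "p = a * f + b * g" for p a b
    proof -
      obtain q r where qr: "pseudo_divmod p e = (q, r)" by fastforce
      define c where "c = coeff e (degree e) ^ (Suc (degree p) - degree e)"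
      have eq: "[:c:] * p = e * q + r" and small: "r = 0 \<or> degree r < degree e"
        using pseudo_divmod[OF nz qr] by (simp_all add: c_def)
      have "r = ([:c:] * a - u * q) * f + ([:c:] * b - v * q) * g"
        using eq unfolding that uv by (simp add: algebra_simps)
      then have "r = 0"
        using small least[of r] unfolding J_def by (metis leD)
      then have "h dvd [:c:] * p" using eq h
        by (metis add.right_neutral dvd_mult2 dvd_triv_right)
      moreover have "c \<noteq> 0" using nz by (simp add: c_def)
      ultimately show ?thesis using dvd_cancel_const_poly[OF free] by blast
    qed
    from dvd[of f 1 0] obtain m where m: "f = h * m" by (auto simp: dvd_def)
    have "degree h \<noteq> 0" using False h nz
      by (metis degree_pCons_0 degree_mult_eq mult_zero_left mult_zero_right add_0)
    then have "\<not> is_unit h" by (auto simp: is_unit_poly_iff)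
    then have "is_unit m" using assms(1) m by (metis irreducibleD)
    then have "f dvd h" using m by (simp add: mult_unit_dvd_iff)
    moreover have "h dvd g" by (rule dvd[of g 0 1]) simp
    ultimately show ?thesis using assms(2) dvd_trans by blast
  qed
qed

text \<open>
  Bezout's identity leaves finitely many first coordinates. On a vertical line one of the two
  polynomials is not identically zero: if \<open>f\<close> vanishes on it, then \<open>f\<close> is its equation, which
  does not divide \<open>g\<close>.
\<close>
lemma finite_common_zeros:
  fixes f g :: "'a::alg_closed_field poly poly"
  assumes "irreducible f" and "\<not> f dvd g"
  shows "finite {P. eval2 f P = 0 \<and> eval2 g P = 0}"
proof -
  obtain u v c where c: "c \<noteq> 0" "u * f + v * g = [:c:]"
    using irreducible_Bezout[OF assms] .
  have root: "poly c (fst P) = 0" if "eval2 f P = 0" "eval2 g P = 0" for P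
    using arg_cong[OF c(2), of "\<lambda>h. eval2 h P"] that by simp
  have "finite {y. eval2 f (x, y) = 0 \<and> eval2 g (x, y) = 0}" for x
  proof (cases "fibre_poly x f = 0")
    case True
    then obtain m where m: "f = vertical x * m"
      by (auto simp: fibre_poly_eq_0_iff dvd_def)
    have "\<not> is_unit (vertical x)" by (auto simp: is_unit_poly_iff is_unit_pCons_iff)
    then have "is_unit m" using assms(1) m by (metis irreducibleD)
    then have "f dvd vertical x" using m by (simp add: mult_unit_dvd_iff del: mult_pCons_left)
    then have "\<not> vertical x dvd g" using assms(2) dvd_trans by blast
    then have "finite {y. poly (fibre_poly x g) y = 0}"
      by (intro poly_roots_finite) (simp add: fibre_poly_eq_0_iff)
    then show ?thesis by (rule rev_finite_subset) (auto simp: poly_fibre_poly)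
  next
    case False
    then have "finite {y. poly (fibre_poly x f) y = 0}" by (rule poly_roots_finite)
    then show ?thesis by (rule rev_finite_subset) (auto simp: poly_fibre_poly)
  qed
  then have "finite (SIGMA x:{x. poly c x = 0}. {y. eval2 f (x, y) = 0 \<and> eval2 g (x, y) = 0})"
    using poly_roots_finite[OF c(1)] by blast
  then show ?thesis
    by (rule rev_finite_subset) (auto dest: root)
qed

lemma infinite_zero_locus:
  fixes f :: "'a::{alg_closed_field, field_char_0} poly poly"
  assumes "irreducible f"
  shows "infinite (zero_locus {f})"
proof (cases "degree f = 0")
  case True
  then obtain p where p: "f = [:p:]" by (metis degree_eq_zeroE)
  then have "p \<noteq> 0" "\<not> is_unit p"
    using assms by (auto simp: irreducible_def is_unit_const_poly_iff)
  then have "degree p > 0" by (simp add: is_unit_iff_degree)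
  then obtain x where x: "poly p x = 0" using alg_closed_imp_poly_has_root by blast
  have "infinite (range (\<lambda>y::'a. (x, y)))"
    by (meson finite_imageD infinite_UNIV_char_0 inj_onI prod.inject)
  moreover have "range (\<lambda>y. (x, y)) \<subseteq> zero_locus {f}" using x p by auto
  ultimately show ?thesis using finite_subset by blast
next
  case False
  have "fst ` zero_locus {f} \<supseteq> UNIV - {x. poly (lead_coeff f) x = 0}"
  proof
    fix x assume "x \<in> UNIV - {x. poly (lead_coeff f) x = 0}"
    then have "coeff (fibre_poly x f) (degree f) \<noteq> 0"
      by (simp add: fibre_poly_def coeff_map_poly)
    then have "degree (fibre_poly x f) > 0" using False le_degree by fastforce
    then obtain y where "poly (fibre_poly x f) y = 0"
      using alg_closed_imp_poly_has_root by blast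
    then show "x \<in> fst ` zero_locus {f}" by (force simp: poly_fibre_poly)
  qed
  moreover have "infinite (UNIV - {x. poly (lead_coeff f) x = 0})"
    using False by (intro Diff_infinite_finite poly_roots_finite) (auto simp: infinite_UNIV_char_0)
  ultimately show ?thesis using finite_subset finite_imageI by blast
qed

lemma irreducible_dvd_if_infinite:
  fixes f g :: "'a::alg_closed_field poly poly"
  assumes "irreducible f" "infinite S" "\<And>P. P \<in> S \<Longrightarrow> eval2 f P = 0" "\<And>P. P \<in> S \<Longrightarrow> eval2 g P = 0"
  shows "f dvd g"
proof (rule ccontr)
  assume "\<not> f dvd g"
  from finite_common_zeros[OF assms(1) this] have "finite S"
    by (rule rev_finite_subset) (use assms in auto)
  with assms(2) show False ..
qed

lemma eval2_eq_0_if_dvd: "f dvd g \<Longrightarrow> eval2 f P = 0 \<Longrightarrow> eval2 g P = 0"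
  by (auto simp: dvd_def)

lemma vanishes_on_curve:
  fixes f g :: "'a::alg_closed_field poly poly"
  assumes "irreducible f" "infinite S" "\<And>P. P \<in> S \<Longrightarrow> eval2 f P = 0" "\<And>P. P \<in> S \<Longrightarrow> eval2 g P = 0"
    and "eval2 f P = 0"
  shows "eval2 g P = 0"
  using irreducible_dvd_if_infinite[OF assms(1-4)] assms(5) by (rule eval2_eq_0_if_dvd)

lemma zero_locus_eqI:
  fixes f g :: "'a::alg_closed_field poly poly"
  assumes "irreducible f" "irreducible g" "infinite (zero_locus {f} \<inter> zero_locus {g})"
  shows "zero_locus {f} = zero_locus {g}"
proof -
  have "eval2 f P = 0 \<longleftrightarrow> eval2 g P = 0" for P
    using vanishes_on_curve[OF assms(1,3), of g P] vanishes_on_curve[OF assms(2,3), of f P] by auto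
  then show ?thesis by (auto simp: zero_locus_def)
qed

text \<open>
  The degree in the second variable plus the degree of the leading coefficient is additive on
  products and positive on nonzero nonunits, so it can serve as the measure for splitting off
  factors.
\<close>
lemma irreducible_cover:
  fixes g :: "'a::field poly poly"
  assumes "g \<noteq> 0"
  obtains H where "finite H" "\<And>h. h \<in> H \<Longrightarrow> irreducible h" "zero_locus {g} \<subseteq> (\<Union>h\<in>H. zero_locus {h})"
  using assms
proof (induction "degree g + degree (lead_coeff g)" arbitrary: g thesis rule: less_induct)
  case less
  consider "is_unit g" | "irreducible g" | p q where "g = p * q" "\<not> is_unit p" "\<not> is_unit q"
    using less.prems(2) by (auto simp: irreducible_def)
  then show ?case
  proof cases
    case 1
    then obtain v where "g * v = 1" by (auto simp: dvd_def)
    then have "eval2 g P * eval2 v P = 1" for P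
      by (metis eval2_simps(2,6))
    then have "zero_locus {g} = {}" 
      by (metis (no_types, lifting) equals0I in_zero_locus mult_zero_left zero_neq_one)
    then show ?thesis using less.prems(1)[of "{}"] by simp
  next
    case 2
    then show ?thesis using less.prems(1)[of "{g}"] by simp
  next
    case 3
    have nz: "p \<noteq> 0" "q \<noteq> 0" using 3 less.prems(2) by auto
    have pos: "degree r + degree (lead_coeff r) > 0" if "\<not> is_unit r" "r \<noteq> 0" for r :: "'a poly poly"
    proof (rule ccontr)
      assume "\<not> ?thesis"
      then have "degree r = 0" "degree (lead_coeff r) = 0" by auto
      then obtain c where "r = [:[:c:]:]" by (metis degree_eq_zeroE lead_coeff_pCons(2))
      with that show False by (auto simp: is_unit_const_poly_iff dvd_field_iff)
    qed
    have lc: "lead_coeff g = lead_coeff p * lead_coeff q"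
      unfolding 3 by (rule lead_coeff_mult)
    have "degree g = degree p + degree q"
      unfolding 3 using nz by (rule degree_mult_eq)
    moreover have "degree (lead_coeff g) = degree (lead_coeff p) + degree (lead_coeff q)"
      unfolding lc using nz by (intro degree_mult_eq) auto
    ultimately have "degree g + degree (lead_coeff g) =
        degree p + degree (lead_coeff p) + (degree q + degree (lead_coeff q))"
      by linarith
    with pos[of p] pos[of q] 3 nz have
      "degree p + degree (lead_coeff p) < degree g + degree (lead_coeff g)"
      "degree q + degree (lead_coeff q) < degree g + degree (lead_coeff g)" by auto
    from less.hyps[OF this(1) _ nz(1)] less.hyps[OF this(2) _ nz(2)] obtain H H' where
      H: "finite H" "\<And>h. h \<in> H \<Longrightarrow> irreducible h" "zero_locus {p} \<subseteq> (\<Union>h\<in>H. zero_locus {h})"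
      "finite H'" "\<And>h. h \<in> H' \<Longrightarrow> irreducible h" "zero_locus {q} \<subseteq> (\<Union>h\<in>H'. zero_locus {h})"
      by metis
    show ?thesis
      using H by (intro less.prems(1)[of "H \<union> H'"]) (auto simp: 3 zero_locus_def)
  qed
qed

section \<open>Zariski closures and components\<close>

lemma in_zariski_closure:
  "P \<in> zariski_closure S \<longleftrightarrow> (\<forall>g. (\<forall>Q\<in>S. eval2 g Q = 0) \<longrightarrow> eval2 g P = 0)"
proof -
  have "P \<in> zariski_closure S \<longleftrightarrow> (\<forall>F. S \<subseteq> zero_locus F \<longrightarrow> P \<in> zero_locus F)"
    by (auto simp: zariski_closure_def algebraic_set_def)
  also have "\<dots> \<longleftrightarrow> (\<forall>g. (\<forall>Q\<in>S. eval2 g Q = 0) \<longrightarrow> eval2 g P = 0)"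
  proof (intro iffI allI impI)
    fix g assume *: "\<forall>F. S \<subseteq> zero_locus F \<longrightarrow> P \<in> zero_locus F" "\<forall>Q\<in>S. eval2 g Q = 0"
    then have "S \<subseteq> zero_locus {g}" by auto
    with * have "P \<in> zero_locus {g}" by blast
    then show "eval2 g P = 0" by simp
  next
    fix F assume "\<forall>g. (\<forall>Q\<in>S. eval2 g Q = 0) \<longrightarrow> eval2 g P = 0" "S \<subseteq> zero_locus F"
    then show "P \<in> zero_locus F" unfolding zero_locus_def by blast
  qed
  finally show ?thesis .
qed

lemma algebraic_set_zero_locus [simp]: "algebraic_set (zero_locus F)"
  by (auto simp: algebraic_set_def)

lemma algebraic_set_zariski_closure: "algebraic_set (zariski_closure S)"
proof -
  have "zariski_closure S = zero_locus {g. \<forall>Q\<in>S. eval2 g Q = 0}"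
    by (auto simp: in_zariski_closure zero_locus_def)
  then show ?thesis by (auto simp: algebraic_set_def)
qed

lemma subset_zariski_closure: "S \<subseteq> zariski_closure S"
  by (auto simp: in_zariski_closure)

lemma zariski_closure_minimal: "algebraic_set V \<Longrightarrow> S \<subseteq> V \<Longrightarrow> zariski_closure S \<subseteq> V"
  by (auto simp: zariski_closure_def)

lemma algebraic_set_Int_zero_locus: "algebraic_set V \<Longrightarrow> algebraic_set (V \<inter> zero_locus {g})"
proof (unfold algebraic_set_def, elim exE)
  fix F assume "V = zero_locus F"
  then show "\<exists>F. V \<inter> zero_locus {g} = zero_locus F"
    by (intro exI[of _ "insert g F"]) (auto simp: zero_locus_def)
qed

lemma eval2_prod: "eval2 (\<Prod>h\<in>H. k h) P = (\<Prod>h\<in>H. eval2 (k h) P)"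
  by (induction H rule: infinite_finite_induct) auto

lemma zero_locus_prod:
  fixes H :: "'a::idom poly poly set"
  shows "finite H \<Longrightarrow> zero_locus {\<Prod>H} = (\<Union>h\<in>H. zero_locus {h})"
  by (auto simp: eval2_prod)

lemma curve_subset_if_infinite:
  fixes h :: "'a::alg_closed_field poly poly"
  assumes "irreducible h" "algebraic_set V" "infinite (V \<inter> zero_locus {h})"
  shows "zero_locus {h} \<subseteq> V"
proof -
  obtain F where F: "V = zero_locus F" using assms(2) by (auto simp: algebraic_set_def)
  have "eval2 g P = 0" if "g \<in> F" "eval2 h P = 0" for g P
    using vanishes_on_curve[OF assms(1,3), of g P] that by (auto simp: F zero_locus_def)
  then show ?thesis by (auto simp: F zero_locus_def)
qed

lemma irreducible_algebraic_set_curve: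
  fixes h :: "'a::{alg_closed_field, field_char_0} poly poly"
  assumes "irreducible h"
  shows "irreducible_algebraic_set (zero_locus {h})"
  unfolding irreducible_algebraic_set_def
proof (intro conjI allI impI)
  show "zero_locus {h} \<noteq> {}" using infinite_zero_locus[OF assms] by auto
next
  fix V1 V2 assume V: "algebraic_set V1" "algebraic_set V2" "zero_locus {h} = V1 \<union> V2"
  then have "infinite V1 \<or> infinite V2"
    using infinite_zero_locus[OF assms] by (metis finite_Un)
  then have "zero_locus {h} \<subseteq> V1 \<or> zero_locus {h} \<subseteq> V2"
  proof (elim disj_forward)
    assume "infinite V1"
    then have "infinite (V1 \<inter> zero_locus {h})" by (simp add: V(3) Int_absorb2)
    then show "zero_locus {h} \<subseteq> V1" by (rule curve_subset_if_infinite[OF assms V(1)])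
  next
    assume "infinite V2"
    then have "infinite (V2 \<inter> zero_locus {h})" by (simp add: V(3) Int_absorb2)
    then show "zero_locus {h} \<subseteq> V2" by (rule curve_subset_if_infinite[OF assms V(2)])
  qed
  then show "zero_locus {h} = V1 \<or> zero_locus {h} = V2"
    unfolding V(3) by blast
qed simp

lemma irreducible_algebraic_set_cover:
  fixes H :: "'a::idom poly poly set"
  assumes "irreducible_algebraic_set D" "finite H" "D \<subseteq> (\<Union>h\<in>H. zero_locus {h})"
  obtains h where "h \<in> H" "D \<subseteq> zero_locus {h}"
  using assms(2,3)
proof (induction H arbitrary: thesis rule: finite_induct)
  case empty
  then show ?case using assms(1) by (auto simp: irreducible_algebraic_set_def)
next
  case (insert h H)
  have "D = (D \<inter> zero_locus {h}) \<union> (D \<inter> zero_locus {\<Prod>H})"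
    using insert.prems(2) insert.hyps(1) by (subst zero_locus_prod) auto
  moreover have "algebraic_set (D \<inter> zero_locus {g})" for g
    using assms(1) by (intro algebraic_set_Int_zero_locus) (simp add: irreducible_algebraic_set_def)
  ultimately have "D = D \<inter> zero_locus {h} \<or> D = D \<inter> zero_locus {\<Prod>H}"
    using assms(1) unfolding irreducible_algebraic_set_def by blast
  then show ?case
  proof
    assume "D = D \<inter> zero_locus {h}"
    then show ?thesis using insert.prems(1)[of h] by auto
  next
    assume "D = D \<inter> zero_locus {\<Prod>H}"
    then have "D \<subseteq> (\<Union>h\<in>H. zero_locus {h})" using zero_locus_prod[OF insert.hyps(1)] by auto
    then show ?thesis using insert.IH insert.prems(1) by blast
  qed
qed

definition curves_through :: "('a::field \<times> 'a) set \<Rightarrow> ('a \<times> 'a) set set" where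
  "curves_through S = {zero_locus {h} | h. irreducible h \<and> infinite (S \<inter> zero_locus {h})}"

text \<open>
  Since \<open>S\<close> has no isolated points, deleting the finitely many points of \<open>S\<close> on those factors of
  \<open>g\<close> that meet \<open>S\<close> finitely does not change the closure. What remains is covered by the other
  factors, and each of these lies in the closure.
\<close>
lemma
  fixes S :: "('a::{alg_closed_field, field_char_0} \<times> 'a) set"
  assumes "g \<noteq> 0" and "S \<subseteq> zero_locus {g}"
    and no_isolated: "\<And>F f. finite F \<Longrightarrow> \<forall>P\<in>S - F. eval2 f P = 0 \<Longrightarrow> \<forall>P\<in>S. eval2 f P = 0"
  shows components_zariski_closure: "components (zariski_closure S) = curves_through S"
    and curves_through_cover: "S \<subseteq> \<Union>(curves_through S)"
proof -
  obtain H0 where H0: "finite H0" "\<And>h. h \<in> H0 \<Longrightarrow> irreducible h"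
    "zero_locus {g} \<subseteq> (\<Union>h\<in>H0. zero_locus {h})"
    using irreducible_cover[OF assms(1)] by blast
  define H where "H = {h \<in> H0. infinite (S \<inter> zero_locus {h})}"
  have fin: "finite H" using H0 by (simp add: H_def)
  define F where "F = (\<Union>h\<in>H0 - H. S \<inter> zero_locus {h})"
  have "finite F" unfolding F_def using H0(1) by (intro finite_UN_I) (auto simp: H_def)
  moreover have "\<forall>P\<in>S - F. eval2 (\<Prod>H) P = 0"
  proof
    fix P assume P: "P \<in> S - F"
    then obtain h where "h \<in> H0" "P \<in> zero_locus {h}" using assms(2) H0(3) by blast
    with P have "h \<in> H" "P \<in> zero_locus {h}" by (auto simp: F_def)
    then have "P \<in> zero_locus {\<Prod>H}" using zero_locus_prod[OF fin] by blast
    then show "eval2 (\<Prod>H) P = 0" by simp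
  qed
  ultimately have "\<forall>P\<in>S. eval2 (\<Prod>H) P = 0" by (rule no_isolated)
  then have S: "S \<subseteq> zero_locus {\<Prod>H}" by auto
  then have cover: "zariski_closure S \<subseteq> (\<Union>h\<in>H. zero_locus {h})"
    using zariski_closure_minimal[OF algebraic_set_zero_locus S] zero_locus_prod[OF fin] by simp
  have irr: "irreducible h" "infinite (S \<inter> zero_locus {h})" if "h \<in> H" for h
    using that H0(2) by (auto simp: H_def)
  have through: "zero_locus {h} \<in> curves_through S" if "h \<in> H" for h
    using irr[OF that] unfolding curves_through_def by blast
  have "S \<subseteq> (\<Union>h\<in>H. zero_locus {h})" using cover subset_zariski_closure by (rule order_trans[rotated])
  also have "\<dots> \<subseteq> \<Union>(curves_through S)" using through by (intro UN_least Union_upper)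
  finally show "S \<subseteq> \<Union>(curves_through S)" .
  have sub: "zero_locus {h} \<subseteq> zariski_closure S"
    if "irreducible h" "infinite (S \<inter> zero_locus {h})" for h
  proof (rule curve_subset_if_infinite[OF that(1) algebraic_set_zariski_closure])
    show "infinite (zariski_closure S \<inter> zero_locus {h})"
      by (rule infinite_super[OF _ that(2)]) (use subset_zariski_closure[of S] in blast)
  qed
  show "components (zariski_closure S) = curves_through S"
  proof (intro equalityI subsetI)
    fix D assume "D \<in> components (zariski_closure S)"
    then have D: "irreducible_algebraic_set D" "D \<subseteq> zariski_closure S"
      "\<And>W. irreducible_algebraic_set W \<Longrightarrow> D \<subseteq> W \<Longrightarrow> W \<subseteq> zariski_closure S \<Longrightarrow> W = D"
      unfolding components_def by blast+
    obtain h where h: "h \<in> H" "D \<subseteq> zero_locus {h}"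
      using irreducible_algebraic_set_cover[OF D(1) fin order_trans[OF D(2) cover]] .
    have "zero_locus {h} = D"
      using irreducible_algebraic_set_curve[OF irr(1)[OF h(1)]] h(2) sub[OF irr[OF h(1)]]
      by (rule D(3))
    with through[OF h(1)] show "D \<in> curves_through S" by simp
  next
    fix D assume "D \<in> curves_through S"
    then obtain h where h: "D = zero_locus {h}" "irreducible h" "infinite (S \<inter> zero_locus {h})"
      unfolding curves_through_def by blast
    have "W = D" if W: "irreducible_algebraic_set W" "D \<subseteq> W" "W \<subseteq> zariski_closure S" for W
    proof -
      obtain h' where h': "h' \<in> H" "W \<subseteq> zero_locus {h'}"
        using irreducible_algebraic_set_cover[OF W(1) fin order_trans[OF W(3) cover]] .
      have "zero_locus {h} \<inter> zero_locus {h'} = zero_locus {h}" using W(2) h(1) h'(2) by blast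
      then have "zero_locus {h} = zero_locus {h'}"
        using zero_locus_eqI[OF h(2) irr(1)[OF h'(1)]] infinite_zero_locus[OF h(2)] by simp
      then show "W = D" using W(2) h' h(1) by blast
    qed
    then show "D \<in> components (zariski_closure S)"
      using irreducible_algebraic_set_curve[OF h(2)] sub[OF h(2,3)]
      unfolding components_def h(1)[symmetric] by blast
  qed
qed

section \<open>Rational functions and parametrizations\<close>

text \<open>
  Rational functions are handled as total functions that agree almost everywhere with a quotient
  of polynomials. They are closed under the field operations of pointwise arithmetic; division
  by the zero function is harmless because \<open>x / 0 = 0\<close>.
\<close>
definition rational_fun :: "('a::field \<Rightarrow> 'a) \<Rightarrow> bool" where
  "rational_fun \<phi> \<longleftrightarrow> (\<exists>p q. q \<noteq> 0 \<and> (\<forall>\<^sub>\<infinity>t. \<phi> t = poly p t / poly q t))"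

lemma infinite_if_MOST:
  fixes P :: "'a::field_char_0 \<Rightarrow> bool"
  assumes "\<forall>\<^sub>\<infinity>t. P t"
  shows "infinite {t. P t}"
  using MOST_INFM[OF infinite_UNIV_char_0 assms] unfolding INFM_iff_infinite .

lemma MOST_poly_nonzero:
  fixes q :: "'a::idom poly"
  shows "q \<noteq> 0 \<Longrightarrow> \<forall>\<^sub>\<infinity>t. poly q t \<noteq> 0"
  by (simp add: MOST_iff_cofinite poly_roots_finite)

lemma rational_fun_quotient: "q \<noteq> 0 \<Longrightarrow> rational_fun (\<lambda>t. poly p t / poly q t)"
  unfolding rational_fun_def by (intro exI[of _ p] exI[of _ q]) simp

lemma rational_fun_const [intro]: "rational_fun (\<lambda>t. c)"
  unfolding rational_fun_def by (intro exI[of _ "[:c:]"] exI[of _ 1]) simp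

lemma rational_fun_add [intro]:
  assumes "rational_fun \<phi>" "rational_fun \<psi>"
  shows "rational_fun (\<lambda>t. \<phi> t + \<psi> t)"
proof -
  obtain p q p' q' where *: "q \<noteq> 0" "\<forall>\<^sub>\<infinity>t. \<phi> t = poly p t / poly q t"
    "q' \<noteq> 0" "\<forall>\<^sub>\<infinity>t. \<psi> t = poly p' t / poly q' t"
    using assms unfolding rational_fun_def by blast
  have "\<forall>\<^sub>\<infinity>t. \<phi> t + \<psi> t = poly (p * q' + p' * q) t / poly (q * q') t"
    using *(2,4) MOST_poly_nonzero[OF *(1)] MOST_poly_nonzero[OF *(3)]
    by eventually_elim (simp add: add_frac_eq)
  moreover have "q * q' \<noteq> 0" using * by simp
  ultimately show ?thesis unfolding rational_fun_def by blast
qed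

lemma rational_fun_mult [intro]:
  assumes "rational_fun \<phi>" "rational_fun \<psi>"
  shows "rational_fun (\<lambda>t. \<phi> t * \<psi> t)"
proof -
  obtain p q p' q' where *: "q \<noteq> 0" "\<forall>\<^sub>\<infinity>t. \<phi> t = poly p t / poly q t"
    "q' \<noteq> 0" "\<forall>\<^sub>\<infinity>t. \<psi> t = poly p' t / poly q' t"
    using assms unfolding rational_fun_def by blast
  have "\<forall>\<^sub>\<infinity>t. \<phi> t * \<psi> t = poly (p * p') t / poly (q * q') t"
    using *(2,4) by eventually_elim simp
  moreover have "q * q' \<noteq> 0" using * by simp
  ultimately show ?thesis unfolding rational_fun_def by blast
qed

lemma rational_fun_divide [intro]:
  assumes "rational_fun \<phi>" "rational_fun \<psi>"
  shows "rational_fun (\<lambda>t. \<phi> t / \<psi> t)"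
proof -
  have "rational_fun (\<lambda>t. inverse (\<psi> t))"
  proof -
    obtain p q where *: "q \<noteq> 0" "\<forall>\<^sub>\<infinity>t. \<psi> t = poly p t / poly q t"
      using assms(2) unfolding rational_fun_def by blast
    show ?thesis
    proof (cases "p = 0")
      case True
      have "\<forall>\<^sub>\<infinity>t. inverse (\<psi> t) = poly 0 t / poly 1 t"
        using *(2) by eventually_elim (simp add: True)
      then show ?thesis unfolding rational_fun_def by (intro exI[of _ 0] exI[of _ 1]) simp
    next
      case False
      have "\<forall>\<^sub>\<infinity>t. inverse (\<psi> t) = poly q t / poly p t"
        using *(2) by eventually_elim simp
      with False show ?thesis unfolding rational_fun_def by (intro exI[of _ q] exI[of _ p]) simp
    qed
  qed
  from rational_fun_mult[OF assms(1) this] show ?thesis by (simp add: divide_inverse)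
qed

lemma rational_fun_diff [intro]:
  assumes "rational_fun \<phi>" "rational_fun \<psi>"
  shows "rational_fun (\<lambda>t. \<phi> t - \<psi> t)"
  using rational_fun_add[OF assms(1) rational_fun_mult[OF rational_fun_const[of "-1"] assms(2)]]
  by simp

lemma rational_fun_eval2:
  assumes "rational_fun (\<lambda>t. fst (\<gamma> t))" "rational_fun (\<lambda>t. snd (\<gamma> t))"
  shows "rational_fun (\<lambda>t. eval2 g (\<gamma> t))"
  by (induction g rule: eval2_induct) (use assms in auto)

lemma rational_fun_MOST_eq_0:
  fixes \<phi> :: "'a::field \<Rightarrow> 'a"
  assumes "rational_fun \<phi>" "infinite {t. \<phi> t = 0}"
  shows "\<forall>\<^sub>\<infinity>t. \<phi> t = 0"
proof -
  obtain p q where *: "q \<noteq> 0" "\<forall>\<^sub>\<infinity>t. \<phi> t = poly p t / poly q t"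
    using assms unfolding rational_fun_def by blast
  have "p = 0"
  proof (rule ccontr)
    assume "p \<noteq> 0"
    have "\<forall>\<^sub>\<infinity>t. \<phi> t \<noteq> 0"
      using *(2) MOST_poly_nonzero[OF \<open>p \<noteq> 0\<close>] MOST_poly_nonzero[OF *(1)]
      by eventually_elim simp
    with assms(2) show False by (simp add: MOST_iff_cofinite)
  qed
  with *(2) show ?thesis by simp
qed

text \<open>
  Finite fibres express nonconstancy: a rational function that takes a value infinitely often is
  almost everywhere equal to it.
\<close>
definition rational_map :: "('a::field \<Rightarrow> 'a \<times> 'a) \<Rightarrow> bool" where
  "rational_map \<gamma> \<longleftrightarrow> rational_fun (\<lambda>t. fst (\<gamma> t)) \<and> rational_fun (\<lambda>t. snd (\<gamma> t)) \<and>
     (\<forall>P. finite {t. \<gamma> t = P})"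

lemma infinite_image_finite_fibres:
  assumes "\<And>P. finite {t. \<gamma> t = P}" "infinite A"
  shows "infinite (\<gamma> ` A)"
proof
  assume "finite (\<gamma> ` A)"
  then have "finite (\<Union>P\<in>\<gamma> ` A. {t. \<gamma> t = P})" using assms(1) by blast
  then have "finite A" by (rule rev_finite_subset) auto
  with assms(2) show False ..
qed

lemma rational_map_MOST_notin:
  assumes "rational_map \<gamma>" "finite F"
  shows "\<forall>\<^sub>\<infinity>t. \<gamma> t \<notin> F"
proof -
  have "finite (\<Union>P\<in>F. {t. \<gamma> t = P})" using assms by (auto simp: rational_map_def)
  then show ?thesis unfolding MOST_iff_cofinite by (rule rev_finite_subset) auto
qed

lemma rational_map_eval2:
  assumes "rational_map \<gamma>" "infinite {t. eval2 g (\<gamma> t) = 0}"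
  shows "\<forall>\<^sub>\<infinity>t. eval2 g (\<gamma> t) = 0"
  using assms by (intro rational_fun_MOST_eq_0 rational_fun_eval2) (auto simp: rational_map_def)

text \<open>
  Evaluation at a pair of fractions has polynomial numerator wherever the denominators are
  nonzero. Unlike \<open>rational_fun_eval2\<close>, this also controls the exceptional parameters.
\<close>
lemma eval2_rational_substitution:
  fixes g :: "'a::field poly poly"
  obtains R n where "\<And>t. poly q t \<noteq> 0 \<Longrightarrow> poly q' t \<noteq> 0 \<Longrightarrow>
    eval2 g (poly p t / poly q t, poly p' t / poly q' t) * (poly q t * poly q' t) ^ n = poly R t"
proof -
  let ?d = "\<lambda>t. poly q t * poly q' t" and ?\<gamma> = "\<lambda>t. (poly p t / poly q t, poly p' t / poly q' t)"
  have "\<exists>R n. \<forall>t. ?d t \<noteq> 0 \<longrightarrow> eval2 g (?\<gamma> t) * ?d t ^ n = poly R t"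
  proof (induction g rule: eval2_induct)
    case (const c)
    show ?case by (intro exI[of _ "[:c:]"] exI[of _ 0]) simp
  next
    case fst
    show ?case by (intro exI[of _ "p * q'"] exI[of _ 1]) simp
  next
    case snd
    show ?case by (intro exI[of _ "p' * q"] exI[of _ 1]) simp
  next
    case (add g h)
    then obtain R n R' n' where *: "\<And>t. ?d t \<noteq> 0 \<Longrightarrow> g (?\<gamma> t) * ?d t ^ n = poly R t"
      "\<And>t. ?d t \<noteq> 0 \<Longrightarrow> h (?\<gamma> t) * ?d t ^ n' = poly R' t" by metis
    show ?case
    proof (intro exI allI impI)
      fix t assume "?d t \<noteq> 0"
      then show "(g (?\<gamma> t) + h (?\<gamma> t)) * ?d t ^ (n + n') =
          poly (R * (q * q') ^ n' + R' * (q * q') ^ n) t"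
        by (simp add: *[symmetric] poly_power power_add algebra_simps)
    qed
  next
    case (mult g h)
    then obtain R n R' n' where *: "\<And>t. ?d t \<noteq> 0 \<Longrightarrow> g (?\<gamma> t) * ?d t ^ n = poly R t"
      "\<And>t. ?d t \<noteq> 0 \<Longrightarrow> h (?\<gamma> t) * ?d t ^ n' = poly R' t" by metis
    show ?case
    proof (intro exI allI impI)
      fix t assume "?d t \<noteq> 0"
      then show "(g (?\<gamma> t) * h (?\<gamma> t)) * ?d t ^ (n + n') = poly (R * R') t"
        by (simp add: *[symmetric] power_add algebra_simps)
    qed
  qed
  then show ?thesis using that by (metis mult_eq_0_iff)
qed

lemma eval2_rational_substitution_eq_0:
  fixes g :: "'a::field poly poly"
  assumes "infinite {t. poly q t \<noteq> 0 \<and> poly q' t \<noteq> 0 \<and>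
      eval2 g (poly p t / poly q t, poly p' t / poly q' t) = 0}"
    and "poly q t \<noteq> 0" "poly q' t \<noteq> 0"
  shows "eval2 g (poly p t / poly q t, poly p' t / poly q' t) = 0"
proof -
  obtain R n where R: "\<And>t. poly q t \<noteq> 0 \<Longrightarrow> poly q' t \<noteq> 0 \<Longrightarrow>
    eval2 g (poly p t / poly q t, poly p' t / poly q' t) * (poly q t * poly q' t) ^ n = poly R t"
    using eval2_rational_substitution by blast
  have "R = 0"
  proof (rule ccontr)
    assume "R \<noteq> 0"
    then have "finite {t. poly R t = 0}" by (rule poly_roots_finite)
    moreover have "{t. poly q t \<noteq> 0 \<and> poly q' t \<noteq> 0 \<and>
      eval2 g (poly p t / poly q t, poly p' t / poly q' t) = 0} \<subseteq> {t. poly R t = 0}"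
      by (auto simp: R[symmetric])
    ultimately show False using assms(1) finite_subset by blast
  qed
  then show ?thesis using R[OF assms(2,3)] assms(2,3) by simp
qed

lemma Fract_eq_const:
  assumes "q \<noteq> 0" "infinite {t. poly p t / poly q t = c}"
  shows "Fract p q = Fract [:c:] (1 :: 'a::field poly)"
proof -
  have "p - smult c q = 0"
  proof (rule ccontr)
    assume "p - smult c q \<noteq> 0"
    then have "finite ({t. poly (p - smult c q) t = 0} \<union> {t. poly q t = 0})"
      using assms(1) poly_roots_finite by blast
    moreover have "{t. poly p t / poly q t = c} \<subseteq>
        {t. poly (p - smult c q) t = 0} \<union> {t. poly q t = 0}" by auto
    ultimately show False using assms(2) finite_subset by blast
  qed
  then show ?thesis using assms(1) by (simp add: eq_fract)
qed

lemma Fract_eq_MOST: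
  assumes "Fract p q = Fract p' q'" "q \<noteq> 0" "q' \<noteq> (0 :: 'a::field poly)"
  shows "\<forall>\<^sub>\<infinity>t. poly p t / poly q t = poly p' t / poly q' t"
proof -
  have "p * q' = p' * q" using assms by (simp add: eq_fract)
  then have *: "poly p t * poly q' t = poly p' t * poly q t" for t by (metis poly_mult)
  show ?thesis
    using MOST_poly_nonzero[OF assms(2)] MOST_poly_nonzero[OF assms(3)]
    by eventually_elim (simp add: frac_eq_eq *)
qed

lemma constant_ratfun_MOST:
  assumes "constant_ratfun (Fract p q)" "q \<noteq> 0"
  obtains c where "\<forall>\<^sub>\<infinity>t. poly p t / poly q t = c"
proof -
  obtain c where "Fract p q = Fract [:c:] 1"
    using assms(1) unfolding constant_ratfun_def by (rule exE)
  from Fract_eq_MOST[OF this assms(2) one_neq_zero] have "\<forall>\<^sub>\<infinity>t. poly p t / poly q t = c" by simp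
  then show ?thesis by (rule that)
qed

lemma rational_curveE:
  assumes "rational_curve C"
  obtains r s where "is_parametrization C r s"
  using assms unfolding rational_curve_def by blast

text \<open>
  The values of a pair of rational functions are dense in an irreducible curve as soon as
  infinitely many of them lie on it. Hence a curve is rational once it receives any nonconstant
  rational map; birationality never has to be considered.
\<close>
lemma rational_curve_iff:
  fixes h :: "'a::{alg_closed_field, field_char_0} poly poly"
  assumes "irreducible h"
  shows "rational_curve (zero_locus {h}) \<longleftrightarrow>
    (\<exists>\<gamma>. rational_map \<gamma> \<and> (\<forall>\<^sub>\<infinity>t. eval2 h (\<gamma> t) = 0))"
proof
  assume "rational_curve (zero_locus {h})"
  then obtain r s where par: "is_parametrization (zero_locus {h}) r s"
    by (rule rational_curveE)
  obtain p q where r: "r = Fract p q" "q \<noteq> 0" by (cases r)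
  obtain p' q' where s: "s = Fract p' q'" "q' \<noteq> 0" by (cases s)
  have nc: "\<not> (constant_ratfun r \<and> constant_ratfun s)"
    using par unfolding is_parametrization_def by (rule conjunct1)
  have cl: "zariski_closure {(u, v). \<exists>t. ratfun_value r t u \<and> ratfun_value s t v} = zero_locus {h}"
    using par unfolding is_parametrization_def by (rule conjunct2)
  define \<gamma> where "\<gamma> = (\<lambda>t. (poly p t / poly q t, poly p' t / poly q' t))"
  have "finite {t. \<gamma> t = P}" for P
  proof (rule ccontr)
    assume inf: "infinite {t. \<gamma> t = P}"
    have "infinite {t. poly p t / poly q t = fst P}" "infinite {t. poly p' t / poly q' t = snd P}"
      by (rule infinite_super[OF _ inf]; auto simp: \<gamma>_def)+
    from Fract_eq_const[OF r(2) this(1)] Fract_eq_const[OF s(2) this(2)] nc show False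
      unfolding constant_ratfun_def r(1) s(1) by blast
  qed
  then have "rational_map \<gamma>"
    using r(2) s(2) by (auto simp: rational_map_def \<gamma>_def intro: rational_fun_quotient)
  moreover have "\<forall>\<^sub>\<infinity>t. eval2 h (\<gamma> t) = 0"
    using MOST_poly_nonzero[OF r(2)] MOST_poly_nonzero[OF s(2)]
  proof eventually_elim
    case (elim t)
    have "ratfun_value r t (fst (\<gamma> t))"
      unfolding ratfun_value_def r(1) \<gamma>_def using elim by (intro exI[of _ p] exI[of _ q]) simp
    moreover have "ratfun_value s t (snd (\<gamma> t))"
      unfolding ratfun_value_def s(1) \<gamma>_def using elim by (intro exI[of _ p'] exI[of _ q']) simp
    ultimately have "\<gamma> t \<in> {(u, v). \<exists>t. ratfun_value r t u \<and> ratfun_value s t v}"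
      unfolding case_prod_beta by blast
    from subsetD[OF subset_zariski_closure this] have "\<gamma> t \<in> zero_locus {h}" unfolding cl .
    then show ?case by simp
  qed
  ultimately show "\<exists>\<gamma>. rational_map \<gamma> \<and> (\<forall>\<^sub>\<infinity>t. eval2 h (\<gamma> t) = 0)" by blast
next
  assume "\<exists>\<gamma>. rational_map \<gamma> \<and> (\<forall>\<^sub>\<infinity>t. eval2 h (\<gamma> t) = 0)"
  then obtain \<gamma> where \<gamma>: "rational_map \<gamma>" "\<forall>\<^sub>\<infinity>t. eval2 h (\<gamma> t) = 0"
    by blast
  then obtain p q p' q' where nz: "q \<noteq> 0" "q' \<noteq> 0"
    and pq: "\<forall>\<^sub>\<infinity>t. fst (\<gamma> t) = poly p t / poly q t" "\<forall>\<^sub>\<infinity>t. snd (\<gamma> t) = poly p' t / poly q' t"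
    unfolding rational_map_def rational_fun_def by blast
  define r s where "r = Fract p q" and "s = Fract p' q'"
  define T where "T = {(u, v). \<exists>t. ratfun_value r t u \<and> ratfun_value s t v}"
  have "T \<subseteq> zero_locus {h}"
  proof
    fix P assume "P \<in> T"
    then obtain t a b a' b' where ab: "r = Fract a b" "poly b t \<noteq> 0" "s = Fract a' b'" "poly b' t \<noteq> 0"
      and P: "P = (poly a t / poly b t, poly a' t / poly b' t)"
      unfolding T_def ratfun_value_def by blast
    from ab have "b \<noteq> 0" "b' \<noteq> 0" by auto
    have "\<forall>\<^sub>\<infinity>t. poly b t \<noteq> 0 \<and> poly b' t \<noteq> 0 \<and>
        eval2 h (poly a t / poly b t, poly a' t / poly b' t) = 0"
      using \<gamma>(2) pq MOST_poly_nonzero[OF \<open>b \<noteq> 0\<close>] MOST_poly_nonzero[OF \<open>b' \<noteq> 0\<close>]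
        Fract_eq_MOST[OF ab(1)[unfolded r_def] nz(1) \<open>b \<noteq> 0\<close>]
        Fract_eq_MOST[OF ab(3)[unfolded s_def] nz(2) \<open>b' \<noteq> 0\<close>]
    proof eventually_elim
      case (elim t)
      then have "\<gamma> t = (poly a t / poly b t, poly a' t / poly b' t)" by (simp add: prod_eq_iff)
      with elim show ?case by simp
    qed
    then have "infinite {t. poly b t \<noteq> 0 \<and> poly b' t \<noteq> 0 \<and>
        eval2 h (poly a t / poly b t, poly a' t / poly b' t) = 0}"
      by (rule infinite_if_MOST)
    from eval2_rational_substitution_eq_0[OF this ab(2,4)] show "P \<in> zero_locus {h}"
      by (simp add: P)
  qed
  have "\<forall>\<^sub>\<infinity>t. \<gamma> t \<in> T"
    using pq MOST_poly_nonzero[OF nz(1)] MOST_poly_nonzero[OF nz(2)]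
  proof eventually_elim
    case (elim t)
    have "ratfun_value r t (fst (\<gamma> t))"
      unfolding ratfun_value_def r_def using elim by (intro exI[of _ p] exI[of _ q]) simp
    moreover have "ratfun_value s t (snd (\<gamma> t))"
      unfolding ratfun_value_def s_def using elim by (intro exI[of _ p'] exI[of _ q']) simp
    ultimately show ?case unfolding T_def case_prod_beta by blast
  qed
  then have "infinite {t. \<gamma> t \<in> T}"
    by (rule infinite_if_MOST)
  then have "infinite (\<gamma> ` {t. \<gamma> t \<in> T})"
    using \<gamma>(1) unfolding rational_map_def by (intro infinite_image_finite_fibres) (elim conjE allE)
  moreover have "\<gamma> ` {t. \<gamma> t \<in> T} \<subseteq> zariski_closure T \<inter> zero_locus {h}"
    using subset_zariski_closure[of T] \<open>T \<subseteq> zero_locus {h}\<close> by auto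
  ultimately have "infinite (zariski_closure T \<inter> zero_locus {h})"
    using infinite_super by metis
  then have cl: "zariski_closure T = zero_locus {h}"
    by (intro subset_antisym curve_subset_if_infinite[OF assms algebraic_set_zariski_closure]
        zariski_closure_minimal[OF algebraic_set_zero_locus \<open>T \<subseteq> zero_locus {h}\<close>])
  have "\<not> (constant_ratfun r \<and> constant_ratfun s)"
  proof
    assume const: "constant_ratfun r \<and> constant_ratfun s"
    obtain c where c: "\<forall>\<^sub>\<infinity>t. poly p t / poly q t = c"
      using constant_ratfun_MOST[OF conjunct1[OF const, unfolded r_def] nz(1)] .
    obtain c' where c': "\<forall>\<^sub>\<infinity>t. poly p' t / poly q' t = c'"
      using constant_ratfun_MOST[OF conjunct2[OF const, unfolded s_def] nz(2)] .
    have "\<forall>\<^sub>\<infinity>t. \<gamma> t = (c, c')"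
      using pq c c'
    by eventually_elim (simp add: prod_eq_iff)
    then have "infinite {t. \<gamma> t = (c, c')}"
      by (rule infinite_if_MOST)
    with \<gamma>(1) show False by (simp add: rational_map_def)
  qed
  then have "is_parametrization (zero_locus {h}) r s"
    unfolding is_parametrization_def T_def[symmetric] using cl by (rule conjI)
  then have "\<exists>r s. is_parametrization (zero_locus {h}) r s" by (intro exI)
  moreover have "irreducible h \<and> zero_locus {h} = zero_locus {h}" using assms by simp
  then have "irreducible_plane_curve (zero_locus {h})"
    unfolding irreducible_plane_curve_def by (rule exI)
  ultimately show "rational_curve (zero_locus {h})"
    by (simp only: rational_curve_def simp_thms)
qed

section \<open>Conchoid points\<close>

definition dilate :: "'a::comm_ring_1 \<times> 'a \<Rightarrow> 'a \<Rightarrow> 'a \<times> 'a \<Rightarrow> 'a \<times> 'a" where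
  "dilate A c x = A + scale c (x - A)"

lemma dilate_1 [simp]: "dilate A 1 x = x"
  by (simp add: dilate_def scale_def prod_eq_iff)

lemma dilate_dilate [simp]: "dilate A c (dilate A e x) = dilate A (c * e) x"
  by (simp add: dilate_def scale_def prod_eq_iff algebra_simps)

lemma norm_sq_scale: "norm_sq (scale c v) = c\<^sup>2 * norm_sq v"
  by (simp add: norm_sq_def scale_def power_mult_distrib algebra_simps)

lemma norm_sq_dilate: "norm_sq (dilate A c x - A) = c\<^sup>2 * norm_sq (x - A)"
  by (simp add: dilate_def norm_sq_scale)

text \<open>
  Here \<open>\<sigma>\<close> is the signed distance from \<open>A\<close> to \<open>y\<close>. The two signs of \<open>\<sigma>\<close> give the two conchoid
  points over \<open>y\<close>.
\<close>
definition conchoid_points :: "('a::field \<times> 'a) set \<Rightarrow> 'a \<times> 'a \<Rightarrow> 'a \<Rightarrow> ('a \<times> 'a) set" where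
  "conchoid_points C A \<delta> =
     {dilate A (1 + \<delta> / \<sigma>) y | y \<sigma>. y \<in> C \<and> \<sigma> \<noteq> 0 \<and> \<sigma>\<^sup>2 = norm_sq (y - A)}"

lemma conchoid_pointsI:
  "y \<in> C \<Longrightarrow> \<sigma> \<noteq> 0 \<Longrightarrow> \<sigma>\<^sup>2 = norm_sq (y - A) \<Longrightarrow> dilate A (1 + \<delta> / \<sigma>) y \<in> conchoid_points C A \<delta>"
  unfolding conchoid_points_def by blast

lemma conchoid_pointsE:
  assumes "z \<in> conchoid_points C A \<delta>"
  obtains y \<sigma> where "z = dilate A (1 + \<delta> / \<sigma>) y" "y \<in> C" "\<sigma> \<noteq> 0" "\<sigma>\<^sup>2 = norm_sq (y - A)"
  using assms unfolding conchoid_points_def by blast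

lemma conchoid_eq_closure:
  fixes \<delta> :: "'a::field"
  assumes "\<delta> \<noteq> 0"
  shows "conchoid C A \<delta> = zariski_closure (conchoid_points C A \<delta>)"
proof -
  have *: "norm_sq (A + scale \<mu> (y - A) - y) = (\<mu> - 1)\<^sup>2 * norm_sq (y - A)" for \<mu> y
    by (simp add: norm_sq_def scale_def power2_eq_square algebra_simps)
  have "(\<exists>y \<mu>. y \<in> C \<and> norm_sq (x - y) = \<delta>\<^sup>2 \<and> x = A + scale \<mu> (y - A)) \<longleftrightarrow>
      (\<exists>y \<sigma>. x = dilate A (1 + \<delta> / \<sigma>) y \<and> y \<in> C \<and> \<sigma> \<noteq> 0 \<and> \<sigma>\<^sup>2 = norm_sq (y - A))" for x
  proof (intro iffI; elim exE conjE)
    fix y \<mu> assume y: "y \<in> C" "norm_sq (x - y) = \<delta>\<^sup>2" "x = A + scale \<mu> (y - A)"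
    then have sq: "(\<mu> - 1)\<^sup>2 * norm_sq (y - A) = \<delta>\<^sup>2" using * by simp
    then have "\<mu> - 1 \<noteq> 0" using assms by auto
    with sq have "(\<delta> / (\<mu> - 1))\<^sup>2 = norm_sq (y - A)"
      by (simp add: power_divide divide_simps mult.commute)
    moreover have "x = dilate A (1 + \<delta> / (\<delta> / (\<mu> - 1))) y"
      using y(3) assms by (simp add: dilate_def)
    ultimately show "\<exists>y \<sigma>. x = dilate A (1 + \<delta> / \<sigma>) y \<and> y \<in> C \<and> \<sigma> \<noteq> 0 \<and> \<sigma>\<^sup>2 = norm_sq (y - A)"
      using y(1) assms \<open>\<mu> - 1 \<noteq> 0\<close> divide_eq_0_iff by blast
  next
    fix y \<sigma> assume y: "x = dilate A (1 + \<delta> / \<sigma>) y" "y \<in> C" "\<sigma> \<noteq> 0" "\<sigma>\<^sup>2 = norm_sq (y - A)"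
    then have "norm_sq (x - y) = \<delta>\<^sup>2"
      using *[of "1 + \<delta> / \<sigma>" y] by (simp add: dilate_def power_divide flip: y(4))
    then show "\<exists>y \<mu>. y \<in> C \<and> norm_sq (x - y) = \<delta>\<^sup>2 \<and> x = A + scale \<mu> (y - A)"
      using y by (intro exI[of _ y] exI[of _ "1 + \<delta> / \<sigma>"]) (simp add: dilate_def)
  qed
  then show ?thesis by (simp add: conchoid_def conchoid_points_def)
qed

lemma conchoid_points_inverse:
  fixes \<delta> :: "'a::field"
  assumes "\<sigma> \<noteq> 0" "\<sigma> + \<delta> \<noteq> 0"
  shows "dilate A (1 + - \<delta> / (\<sigma> + \<delta>)) (dilate A (1 + \<delta> / \<sigma>) y) = y"
proof -
  have "1 + - \<delta> / (\<sigma> + \<delta>) = \<sigma> / (\<sigma> + \<delta>)" "1 + \<delta> / \<sigma> = (\<sigma> + \<delta>) / \<sigma>"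
    using assms by (simp_all add: field_simps)
  then have "(1 + - \<delta> / (\<sigma> + \<delta>)) * (1 + \<delta> / \<sigma>) = 1"
    using assms by simp
  then show ?thesis by (simp del: add_uminus_conv_diff)
qed

lemma norm_sq_conchoid_point:
  fixes \<delta> :: "'a::field"
  assumes "\<sigma> \<noteq> 0" "\<sigma>\<^sup>2 = norm_sq (y - A)"
  shows "norm_sq (dilate A (1 + \<delta> / \<sigma>) y - A) = (\<sigma> + \<delta>)\<^sup>2"
  using assms(1) by (simp add: norm_sq_dilate power2_eq_square field_simps flip: assms(2))

definition norm_sq_poly :: "'a::comm_ring_1 \<times> 'a \<Rightarrow> 'a poly poly" where
  "norm_sq_poly A = [:[:- fst A, 1:]:]\<^sup>2 + ([:0, 1:] - [:[:snd A:]:])\<^sup>2"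

lemma eval2_norm_sq_poly [simp]: "eval2 (norm_sq_poly A) P = norm_sq (P - A)"
proof -
  have "eval2 (norm_sq_poly A) P =
      (eval2 [:[:- fst A, 1:]:] P)\<^sup>2 + (eval2 [:0, 1:] P - eval2 [:[:snd A:]:] P)\<^sup>2"
    unfolding norm_sq_poly_def by (simp only: eval2_simps)
  then show ?thesis by (simp add: norm_sq_def)
qed

text \<open>
  A polynomial in \<open>x\<close> and \<open>1 / \<sigma> = \<sigma> / norm_sq (x - A)\<close> becomes linear in \<open>\<sigma>\<close> after
  multiplication with a power of \<open>norm_sq (x - A) = \<sigma>\<^sup>2\<close>. With \<open>c = \<delta>\<close> this pulls equations on
  the conchoid back to \<open>C\<close>; with \<open>c = - \<delta>\<close> it pulls the equation of \<open>C\<close> back to the conchoid.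
\<close>
lemma eval2_dilate:
  fixes g :: "'a::field poly poly"
  obtains k U V where "\<And>x \<sigma>. \<sigma> \<noteq> 0 \<Longrightarrow> \<sigma>\<^sup>2 = norm_sq (x - A) \<Longrightarrow>
    norm_sq (x - A) ^ k * eval2 g (dilate A (1 + c / \<sigma>) x) = eval2 U x + \<sigma> * eval2 V x"
proof -
  let ?N = "\<lambda>x. norm_sq (x - A)"
  have "\<exists>k U V. \<forall>x \<sigma>. \<sigma> \<noteq> 0 \<and> \<sigma>\<^sup>2 = ?N x \<longrightarrow>
      ?N x ^ k * eval2 g (dilate A (1 + c / \<sigma>) x) = eval2 U x + \<sigma> * eval2 V x"
  proof (induction g rule: eval2_induct)
    case (const e)
    show ?case by (intro exI[of _ "0::nat"] exI[of _ "[:[:e:]:]"] exI[of _ 0]) simp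
  next
    case fst
    show ?case
    proof (intro exI allI impI)
      fix x \<sigma> assume \<sigma>: "\<sigma> \<noteq> 0 \<and> \<sigma>\<^sup>2 = ?N x"
      have "\<sigma>\<^sup>2 * fst (dilate A (1 + c / \<sigma>) x) = \<sigma>\<^sup>2 * fst x + \<sigma> * (c * (fst x - fst A))"
        using conjunct1[OF \<sigma>] by (simp add: dilate_def scale_def power2_eq_square field_simps)
      then show "?N x ^ 1 * fst (dilate A (1 + c / \<sigma>) x) =
          eval2 (norm_sq_poly A * [:[:0, 1:]:]) x + \<sigma> * eval2 ([:[:c:]:] * [:[:- fst A, 1:]:]) x"
        using \<sigma> by (simp del: mult_pCons_left mult_pCons_right)
    qed
  next
    case snd
    show ?case
    proof (intro exI allI impI)
      fix x \<sigma> assume \<sigma>: "\<sigma> \<noteq> 0 \<and> \<sigma>\<^sup>2 = ?N x"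
      have "\<sigma>\<^sup>2 * snd (dilate A (1 + c / \<sigma>) x) = \<sigma>\<^sup>2 * snd x + \<sigma> * (c * (snd x - snd A))"
        using conjunct1[OF \<sigma>] by (simp add: dilate_def scale_def power2_eq_square field_simps)
      then show "?N x ^ 1 * snd (dilate A (1 + c / \<sigma>) x) =
          eval2 (norm_sq_poly A * [:0, 1:]) x + \<sigma> * eval2 ([:[:c:]:] * ([:0, 1:] - [:[:snd A:]:])) x"
        using \<sigma> unfolding eval2_simps by simp
    qed
  next
    case (add g h)
    then obtain k U V k' U' V' where *:
      "\<And>x \<sigma>. \<sigma> \<noteq> 0 \<and> \<sigma>\<^sup>2 = ?N x \<Longrightarrow>
        ?N x ^ k * g (dilate A (1 + c / \<sigma>) x) = eval2 U x + \<sigma> * eval2 V x"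
      "\<And>x \<sigma>. \<sigma> \<noteq> 0 \<and> \<sigma>\<^sup>2 = ?N x \<Longrightarrow>
        ?N x ^ k' * h (dilate A (1 + c / \<sigma>) x) = eval2 U' x + \<sigma> * eval2 V' x" by metis
    show ?case
    proof (intro exI allI impI)
      fix x \<sigma> assume \<sigma>: "\<sigma> \<noteq> 0 \<and> \<sigma>\<^sup>2 = ?N x"
      have "?N x ^ (k + k') * (g (dilate A (1 + c / \<sigma>) x) + h (dilate A (1 + c / \<sigma>) x)) =
          ?N x ^ k' * (?N x ^ k * g (dilate A (1 + c / \<sigma>) x)) +
          ?N x ^ k * (?N x ^ k' * h (dilate A (1 + c / \<sigma>) x))"
        by (simp add: power_add algebra_simps)
      then show "?N x ^ (k + k') * (g (dilate A (1 + c / \<sigma>) x) + h (dilate A (1 + c / \<sigma>) x)) =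
          eval2 (norm_sq_poly A ^ k' * U + norm_sq_poly A ^ k * U') x +
          \<sigma> * eval2 (norm_sq_poly A ^ k' * V + norm_sq_poly A ^ k * V') x"
        unfolding *[OF \<sigma>] by (simp add: algebra_simps)
    qed
  next
    case (mult g h)
    then obtain k U V k' U' V' where *:
      "\<And>x \<sigma>. \<sigma> \<noteq> 0 \<and> \<sigma>\<^sup>2 = ?N x \<Longrightarrow>
        ?N x ^ k * g (dilate A (1 + c / \<sigma>) x) = eval2 U x + \<sigma> * eval2 V x"
      "\<And>x \<sigma>. \<sigma> \<noteq> 0 \<and> \<sigma>\<^sup>2 = ?N x \<Longrightarrow>
        ?N x ^ k' * h (dilate A (1 + c / \<sigma>) x) = eval2 U' x + \<sigma> * eval2 V' x" by metis
    show ?case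
    proof (intro exI allI impI)
      fix x \<sigma> assume \<sigma>: "\<sigma> \<noteq> 0 \<and> \<sigma>\<^sup>2 = ?N x"
      have "?N x ^ (k + k') * (g (dilate A (1 + c / \<sigma>) x) * h (dilate A (1 + c / \<sigma>) x)) =
          (?N x ^ k * g (dilate A (1 + c / \<sigma>) x)) *
          (?N x ^ k' * h (dilate A (1 + c / \<sigma>) x))"
        by (simp add: power_add algebra_simps)
      also have "\<dots> = eval2 U x * eval2 U' x + \<sigma>\<^sup>2 * (eval2 V x * eval2 V' x) +
          \<sigma> * (eval2 U x * eval2 V' x + eval2 V x * eval2 U' x)"
        unfolding *[OF \<sigma>] by (simp add: power2_eq_square algebra_simps)
      finally show "?N x ^ (k + k') * (g (dilate A (1 + c / \<sigma>) x) * h (dilate A (1 + c / \<sigma>) x)) =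
          eval2 (U * U' + norm_sq_poly A * (V * V')) x + \<sigma> * eval2 (U * V' + V * U') x"
        using \<sigma> by simp
    qed
  qed
  then show ?thesis using that by metis
qed

definition line_poly :: "'a::comm_ring_1 \<times> 'a \<Rightarrow> 'a \<times> 'a \<Rightarrow> 'a poly poly" where
  "line_poly A v = [:[:fst v * snd A - snd v * fst A, snd v:], [:- fst v:]:]"

lemma eval2_line_poly:
  "eval2 (line_poly A v) P = snd v * fst P + - fst v * snd P + (fst v * snd A - snd v * fst A)"
  by (simp add: line_poly_def eval2_pCons)

lemma line_poly_eq_0_iff:
  fixes v :: "'a::field \<times> 'a"
  assumes "v \<noteq> 0"
  shows "eval2 (line_poly A v) P = 0 \<longleftrightarrow> P \<in> range (\<lambda>c. A + scale c v)"
proof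
  assume "eval2 (line_poly A v) P = 0"
  then have eq: "snd v * (fst P - fst A) = fst v * (snd P - snd A)"
    by (simp add: eval2_line_poly algebra_simps)
  define c where "c = (if fst v = 0 then (snd P - snd A) / snd v else (fst P - fst A) / fst v)"
  have "P = A + scale c v"
    using assms eq by (cases "fst v = 0") (simp_all add: c_def scale_def prod_eq_iff field_simps)
  then show "P \<in> range (\<lambda>c. A + scale c v)" by (rule range_eqI)
next
  assume "P \<in> range (\<lambda>c. A + scale c v)"
  then obtain c where P: "P = A + scale c v" by (rule rangeE)
  show "eval2 (line_poly A v) P = 0"
    unfolding P eval2_line_poly by (simp add: scale_def algebra_simps)
qed

lemma dilate_ray: "dilate A c (A + scale r e) = A + scale (c * r) e"
  by (simp add: dilate_def scale_def prod_eq_iff algebra_simps)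

lemma norm_sq_ray: "norm_sq (A + scale r e - A) = r\<^sup>2 * norm_sq e"
  by (simp add: norm_sq_scale)

lemma conchoid_point_inverse:
  fixes \<delta> :: "'a::field"
  assumes "z \<in> conchoid_points C A \<delta>" "norm_sq (z - A) \<noteq> 0"
  obtains w where "w \<noteq> 0" "w \<noteq> \<delta>" "w\<^sup>2 = norm_sq (z - A)" "dilate A (1 + - \<delta> / w) z \<in> C"
proof -
  obtain y \<sigma> where y: "z = dilate A (1 + \<delta> / \<sigma>) y" "y \<in> C" "\<sigma> \<noteq> 0" "\<sigma>\<^sup>2 = norm_sq (y - A)"
    using assms(1) by (rule conchoid_pointsE)
  have N: "norm_sq (z - A) = (\<sigma> + \<delta>)\<^sup>2"
    unfolding y(1) by (rule norm_sq_conchoid_point[OF y(3,4)])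
  with assms(2) have nz: "\<sigma> + \<delta> \<noteq> 0" by auto
  show ?thesis
  proof (rule that[of "\<sigma> + \<delta>"])
    show "dilate A (1 + - \<delta> / (\<sigma> + \<delta>)) z \<in> C"
      unfolding y(1) conchoid_points_inverse[OF y(3) nz] by (rule y(2))
  qed (use nz N y(3) in simp_all)
qed

lemma conchoid_point_isotropic:
  fixes \<delta> :: "'a::field"
  assumes "z \<in> conchoid_points C A \<delta>" "norm_sq (z - A) = 0"
  shows "z = A"
proof -
  obtain y \<sigma> where y: "z = dilate A (1 + \<delta> / \<sigma>) y" "y \<in> C" "\<sigma> \<noteq> 0" "\<sigma>\<^sup>2 = norm_sq (y - A)"
    using assms(1) by (rule conchoid_pointsE)
  have "(\<sigma> + \<delta>)\<^sup>2 = 0"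
    using norm_sq_conchoid_point[OF y(3,4), of \<delta>] assms(2) unfolding y(1) by simp
  then have "\<sigma> + \<delta> = 0" by simp
  then have "1 + \<delta> / \<sigma> = 0" using y(3) by (simp add: field_simps)
  then show ?thesis unfolding y(1) by (simp add: dilate_def scale_def prod_eq_iff)
qed

lemma rational_map_MOST_nonzero:
  fixes h g :: "'a::alg_closed_field poly poly"
  assumes "rational_map \<gamma>" "\<forall>\<^sub>\<infinity>t. eval2 h (\<gamma> t) = 0" "irreducible h" "\<not> h dvd g"
  shows "\<forall>\<^sub>\<infinity>t. eval2 g (\<gamma> t) \<noteq> 0"
  using rational_map_MOST_notin[OF assms(1) finite_common_zeros[OF assms(3,4)]] assms(2)
  by eventually_elim simp

lemma rational_map_dilate:
  assumes "rational_map \<gamma>" "rational_fun \<phi>"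
  shows "rational_fun (\<lambda>t. fst (dilate A (\<phi> t) (\<gamma> t)))" "rational_fun (\<lambda>t. snd (dilate A (\<phi> t) (\<gamma> t)))"
proof -
  have \<gamma>: "rational_fun (\<lambda>t. fst (\<gamma> t))" "rational_fun (\<lambda>t. snd (\<gamma> t))"
    using assms(1) unfolding rational_map_def by simp_all
  have "rational_fun (\<lambda>t. fst A + \<phi> t * (fst (\<gamma> t) - fst A))"
    by (intro rational_fun_add rational_fun_mult rational_fun_diff rational_fun_const \<gamma> assms(2))
  then show "rational_fun (\<lambda>t. fst (dilate A (\<phi> t) (\<gamma> t)))"
    by (simp add: dilate_def scale_def)
  have "rational_fun (\<lambda>t. snd A + \<phi> t * (snd (\<gamma> t) - snd A))"
    by (intro rational_fun_add rational_fun_mult rational_fun_diff rational_fun_const \<gamma> assms(2))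
  then show "rational_fun (\<lambda>t. snd (dilate A (\<phi> t) (\<gamma> t)))"
    by (simp add: dilate_def scale_def)
qed

section \<open>A curve with a focus\<close>

locale pointed_curve =
  fixes f :: "'k::{alg_closed_field, field_char_0} poly poly" and A :: "'k \<times> 'k" and \<iota> :: 'k
  assumes irreducible_f: "irreducible f"
    and \<iota>: "\<iota>\<^sup>2 = -1"
    and not_line: "\<not> (affine_line (zero_locus {f}) \<and> A \<in> zero_locus {f})"
begin

abbreviation C where "C \<equiv> zero_locus {f}"
abbreviation N where "N x \<equiv> norm_sq (x - A)"

text \<open>
  If \<open>C\<close> had infinitely many points on a line through \<open>A\<close>, it would contain the line, because
  the line is parametrized by polynomials, and be contained in it, because \<open>f\<close> is irreducible.
\<close>
lemma finite_on_line_param: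
  assumes "v \<noteq> 0"
  shows "finite {c. A + scale c v \<in> C}"
proof (rule ccontr)
  assume inf: "infinite {c. A + scale c v \<in> C}"
  have param: "A + scale c v = (fst A + c * fst v, snd A + c * snd v)" for c
    by (simp add: scale_def prod_eq_iff)
  have all: "A + scale c v \<in> C" for c
    using eval2_rational_substitution_eq_0[of 1 1 f "[:fst A, fst v:]" "[:snd A, snd v:]" c] inf
    by (simp add: param)
  define l where "l = line_poly A v"
  have "inj (\<lambda>c. A + scale c v)"
    using assms by (auto simp: inj_def scale_def prod_eq_iff)
  then have "infinite (range (\<lambda>c. A + scale c v))"
    using finite_imageD infinite_UNIV_char_0 by blast
  moreover have "eval2 f P = 0 \<and> eval2 l P = 0" if "P \<in> range (\<lambda>c. A + scale c v)" for P
    using that all line_poly_eq_0_iff[OF assms, of A P] by (auto simp: l_def)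
  ultimately have "eval2 l P = 0" if "P \<in> C" for P
    using vanishes_on_curve[OF irreducible_f, of _ l P] that by simp
  moreover have "P \<in> C" if "eval2 l P = 0" for P
  proof -
    from that obtain c where P: "P = A + scale c v"
      unfolding l_def line_poly_eq_0_iff[OF assms] by (rule rangeE)
    show ?thesis unfolding P by (rule all)
  qed
  ultimately have "P \<in> C \<longleftrightarrow> eval2 l P = 0" for P by (rule iffI)
  then have "C = {P. eval2 l P = 0}" by (intro set_eqI) (simp only: mem_Collect_eq)
  also have "\<dots> = {(y1, y2). snd v * y1 + - fst v * y2 + (fst v * snd A - snd v * fst A) = 0}"
    by (auto simp: l_def eval2_line_poly)
  finally have "(snd v, - fst v) \<noteq> (0, 0) \<and>
      C = {(y1, y2). snd v * y1 + - fst v * y2 + (fst v * snd A - snd v * fst A) = 0}"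
    using assms by (auto simp: prod_eq_iff)
  then have "affine_line C" unfolding affine_line_def by (intro exI)
  moreover have "A + scale 0 v = A" by (simp add: scale_def prod_eq_iff)
  then have "A \<in> C" using all[of 0] by (simp only:)
  ultimately have "affine_line C \<and> A \<in> C" by (intro conjI)
  with not_line show False by (rule notE)
qed

lemma finite_on_line:
  assumes "v \<noteq> 0"
  shows "finite (C \<inter> range (\<lambda>c. A + scale c v))"
proof -
  have "C \<inter> range (\<lambda>c. A + scale c v) = (\<lambda>c. A + scale c v) ` {c. A + scale c v \<in> C}" by blast
  then show ?thesis using finite_on_line_param[OF assms] by simp
qed

lemma finite_isotropic: "finite {y \<in> C. N y = 0}"
proof (rule finite_subset)
  show "{y \<in> C. N y = 0} \<subseteq>
    C \<inter> range (\<lambda>c. A + scale c (\<iota>, 1)) \<union> C \<inter> range (\<lambda>c. A + scale c (- \<iota>, 1))"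
  proof
    fix y assume y: "y \<in> {y \<in> C. N y = 0}"
    define u w where "u = fst (y - A)" and "w = snd (y - A)"
    have "(u - \<iota> * w) * (u + \<iota> * w) = u\<^sup>2 - \<iota>\<^sup>2 * w\<^sup>2"
      by (simp add: power2_eq_square algebra_simps)
    also have "\<dots> = 0" using y \<iota> by (simp add: norm_sq_def u_def w_def)
    finally have "u - \<iota> * w = 0 \<or> u + \<iota> * w = 0" by (simp only: mult_eq_0_iff)
    then have "u = w * \<iota> \<or> u = w * - \<iota>"
      by (auto simp: eq_neg_iff_add_eq_0 mult.commute)
    then have "y = A + scale w (\<iota>, 1) \<or> y = A + scale w (- \<iota>, 1)"
      by (auto simp: scale_def u_def w_def prod_eq_iff algebra_simps)
    with y show "y \<in> C \<inter> range (\<lambda>c. A + scale c (\<iota>, 1)) \<union> C \<inter> range (\<lambda>c. A + scale c (- \<iota>, 1))"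
      by blast
  qed
  show "finite (C \<inter> range (\<lambda>c. A + scale c (\<iota>, 1)) \<union> C \<inter> range (\<lambda>c. A + scale c (- \<iota>, 1)))"
    by (intro finite_UnI finite_on_line) (auto simp: prod_eq_iff)
qed

text \<open>
  In the coordinates \<open>u + \<iota> w\<close> and \<open>u - \<iota> w\<close> the circle is a hyperbola with product \<open>\<delta>\<^sup>2\<close>, so
  \<open>t = u + \<iota> w\<close> parametrizes it. The argument for lines then applies.
\<close>
lemma finite_on_circle:
  assumes "\<delta> \<noteq> 0" "C \<noteq> circle A \<delta>"
  shows "finite {y \<in> C. N y = \<delta>\<^sup>2}"
proof (rule ccontr)
  assume inf: "infinite {y \<in> C. N y = \<delta>\<^sup>2}"
  have \<iota>0: "\<iota> \<noteq> 0" using \<iota> by auto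
  define p q p' q' where "p = [:\<delta>\<^sup>2, 2 * fst A, 1:]" and "q = [:0, 2 :: 'k:]"
    and "p' = [:- \<delta>\<^sup>2, 2 * \<iota> * snd A, 1:]" and "q' = [:0, 2 * \<iota>:]"
  define T where "T = {t. poly q t \<noteq> 0 \<and> poly q' t \<noteq> 0 \<and>
    eval2 f (poly p t / poly q t, poly p' t / poly q' t) = 0}"
  have param: "\<exists>t. t \<noteq> 0 \<and> y = (poly p t / poly q t, poly p' t / poly q' t)" if "N y = \<delta>\<^sup>2" for y
  proof -
    define u w where "u = fst (y - A)" and "w = snd (y - A)"
    define t where "t = u + \<iota> * w"
    have "(u + \<iota> * w) * (u - \<iota> * w) = u\<^sup>2 - \<iota>\<^sup>2 * w\<^sup>2"
      by (simp add: power2_eq_square algebra_simps)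
    then have uw: "\<delta>\<^sup>2 = t * (u - \<iota> * w)"
      using that \<iota> by (simp add: u_def w_def t_def norm_sq_def)
    with assms(1) have nz: "t \<noteq> 0" by auto
    have "poly p t = 2 * t * (fst A + u)"
      unfolding p_def uw by (simp add: t_def algebra_simps)
    then have "poly p t / poly q t = fst A + u" using nz by (simp add: q_def)
    moreover have "poly p' t = 2 * \<iota> * t * (snd A + w)"
      unfolding p'_def uw by (simp add: t_def algebra_simps)
    then have "poly p' t / poly q' t = snd A + w" using nz \<iota>0 by (simp add: q'_def)
    ultimately have "y = (poly p t / poly q t, poly p' t / poly q' t)"
      by (simp add: u_def w_def prod_eq_iff)
    with nz show ?thesis by (intro exI conjI)
  qed
  have defined: "poly q t \<noteq> 0 \<and> poly q' t \<noteq> 0" if "t \<noteq> 0" for t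
    using that \<iota>0 by (simp add: q_def q'_def)
  have "{y \<in> C. N y = \<delta>\<^sup>2} \<subseteq> (\<lambda>t. (poly p t / poly q t, poly p' t / poly q' t)) ` T"
  proof
    fix y assume y: "y \<in> {y \<in> C. N y = \<delta>\<^sup>2}"
    then obtain t where t: "t \<noteq> 0" "y = (poly p t / poly q t, poly p' t / poly q' t)"
      using param[of y] by auto
    with y defined[of t] have "t \<in> T" by (simp add: T_def)
    with t(2) show "y \<in> (\<lambda>t. (poly p t / poly q t, poly p' t / poly q' t)) ` T" by (rule image_eqI)
  qed
  then have T: "infinite T" using inf by (auto dest: finite_surj)
  have "circle A \<delta> \<subseteq> C"
  proof
    fix y assume "y \<in> circle A \<delta>"
    then obtain t where t: "t \<noteq> 0" "y = (poly p t / poly q t, poly p' t / poly q' t)"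
      using param[of y] by (auto simp: circle_def)
    have "eval2 f (poly p t / poly q t, poly p' t / poly q' t) = 0"
      by (rule eval2_rational_substitution_eq_0[OF T[unfolded T_def]
            conjunct1[OF defined[OF t(1)]] conjunct2[OF defined[OF t(1)]]])
    with t(2) show "y \<in> C" by simp
  qed
  moreover have "C \<subseteq> circle A \<delta>"
  proof
    fix y assume "y \<in> C"
    then have y: "eval2 f y = 0" by simp
    have "eval2 (norm_sq_poly A - [:[:\<delta>\<^sup>2:]:]) y = 0"
      by (rule vanishes_on_curve[OF irreducible_f inf _ _ y]) simp_all
    then show "y \<in> circle A \<delta>" by (simp add: circle_def)
  qed
  ultimately have "C = circle A \<delta>" by (rule subset_antisym[rotated])
  with assms(2) show False by (rule notE)
qed

text \<open>
  The point \<open>A\<close> is reached only from the circle of radius \<open>\<delta>\<close>; this is where that circle has to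
  be excluded. Any other point is reached only from points of \<open>C\<close> on its line through \<open>A\<close>.
\<close>
lemma finite_conchoid_fibre:
  assumes "\<delta> \<noteq> 0" "C \<noteq> circle A \<delta>"
  shows "finite {y \<in> C. \<exists>\<sigma>. \<sigma> \<noteq> 0 \<and> \<sigma>\<^sup>2 = N y \<and> dilate A (1 + \<delta> / \<sigma>) y = z}"
proof (cases "z = A")
  case True
  have "N y = \<delta>\<^sup>2" if "\<sigma> \<noteq> 0" "\<sigma>\<^sup>2 = N y" "dilate A (1 + \<delta> / \<sigma>) y = A" for y \<sigma>
  proof -
    have "(\<sigma> + \<delta>)\<^sup>2 = 0"
      using norm_sq_conchoid_point[OF that(1,2), of \<delta>] that(3) by (simp add: norm_sq_def)
    then have "\<sigma> = - \<delta>" by (simp add: add_eq_0_iff2)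
    then show ?thesis by (simp flip: that(2))
  qed
  then have "{y \<in> C. \<exists>\<sigma>. \<sigma> \<noteq> 0 \<and> \<sigma>\<^sup>2 = N y \<and> dilate A (1 + \<delta> / \<sigma>) y = z} \<subseteq> {y \<in> C. N y = \<delta>\<^sup>2}"
    unfolding True by blast
  then show ?thesis using finite_on_circle[OF assms] by (rule finite_subset)
next
  case False
  have "y \<in> range (\<lambda>c. A + scale c (z - A))" if "\<sigma> \<noteq> 0" "dilate A (1 + \<delta> / \<sigma>) y = z" for y \<sigma>
  proof -
    have "1 + \<delta> / \<sigma> \<noteq> 0" using False that by (auto simp: dilate_def scale_def prod_eq_iff)
    then have "y = dilate A (inverse (1 + \<delta> / \<sigma>)) z" by (simp flip: that(2))
    then show ?thesis by (auto simp: dilate_def)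
  qed
  then have "{y \<in> C. \<exists>\<sigma>. \<sigma> \<noteq> 0 \<and> \<sigma>\<^sup>2 = N y \<and> dilate A (1 + \<delta> / \<sigma>) y = z} \<subseteq>
      C \<inter> range (\<lambda>c. A + scale c (z - A))"
    by blast
  moreover have "finite (C \<inter> range (\<lambda>c. A + scale c (z - A)))"
    using False by (intro finite_on_line) simp
  ultimately show ?thesis by (rule finite_subset)
qed

text \<open>
  The pullback of \<open>g\<close> has the form \<open>U y + \<sigma> V y\<close>. If it vanishes for both signs of \<open>\<sigma>\<close>, then so
  do \<open>U\<close> and \<open>V\<close>, which are polynomials on the irreducible curve \<open>C\<close>. This replaces a discussion
  of whether the double cover of \<open>C\<close> is irreducible.
\<close>
lemma vanishes_on_conchoid_points:
  assumes "infinite Y" "Y \<subseteq> C"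
    and zero: "\<And>y \<sigma>. y \<in> Y \<Longrightarrow> \<sigma> \<noteq> 0 \<Longrightarrow> \<sigma>\<^sup>2 = N y \<Longrightarrow> eval2 g (dilate A (1 + \<delta> / \<sigma>) y) = 0"
    and "z \<in> conchoid_points C A \<delta>"
  shows "eval2 g z = 0"
proof -
  obtain k U V where UV: "\<And>y \<sigma>. \<sigma> \<noteq> 0 \<Longrightarrow> \<sigma>\<^sup>2 = N y \<Longrightarrow>
      N y ^ k * eval2 g (dilate A (1 + \<delta> / \<sigma>) y) = eval2 U y + \<sigma> * eval2 V y"
    by (rule eval2_dilate[of A g \<delta>]) (erule that)
  define Y' where "Y' = Y - {y \<in> C. N y = 0}"
  have inf: "infinite Y'" using assms(1) finite_isotropic by (simp add: Y'_def)
  have UV0: "eval2 U y = 0 \<and> eval2 V y = 0" if "y \<in> Y'" for y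
  proof -
    obtain \<sigma> where \<sigma>: "\<sigma>\<^sup>2 = N y" using nth_root_exists[of 2 "N y"] by auto
    have nz: "\<sigma> \<noteq> 0" using \<sigma> that assms(2) by (auto simp: Y'_def)
    have y: "y \<in> Y" using that by (simp add: Y'_def)
    have "eval2 U y + \<sigma> * eval2 V y = 0" using UV[OF nz \<sigma>] zero[OF y nz \<sigma>] by simp
    moreover have "eval2 U y - \<sigma> * eval2 V y = 0"
      using UV[of "- \<sigma>" y] zero[OF y, of "- \<sigma>"] nz \<sigma> by simp
    ultimately have "2 * eval2 U y = 0" "\<sigma> * eval2 V y = - eval2 U y"
      by (simp_all add: algebra_simps eq_neg_iff_add_eq_0)
    with nz show ?thesis by simp
  qed
  have on_curve: "eval2 f y = 0" if "y \<in> Y'" for y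
    using that assms(2) by (auto simp: Y'_def)
  have U0: "eval2 U y = 0" if "eval2 f y = 0" for y
    using vanishes_on_curve[OF irreducible_f inf on_curve conjunct1[OF UV0] that] .
  have V0: "eval2 V y = 0" if "eval2 f y = 0" for y
    using vanishes_on_curve[OF irreducible_f inf on_curve conjunct2[OF UV0] that] .
  obtain y \<sigma> where "z = dilate A (1 + \<delta> / \<sigma>) y" "y \<in> C" "\<sigma> \<noteq> 0" "\<sigma>\<^sup>2 = N y"
    using assms(4) by (rule conchoid_pointsE)
  moreover from this have "N y \<noteq> 0" by (metis power_not_zero)
  ultimately show ?thesis using UV[of \<sigma> y] U0[of y] V0[of y] by simp
qed

lemma conchoid_points_no_isolated:
  assumes "\<delta> \<noteq> 0" "C \<noteq> circle A \<delta>" "finite F"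
    and "\<forall>P\<in>conchoid_points C A \<delta> - F. eval2 g P = 0"
  shows "\<forall>P\<in>conchoid_points C A \<delta>. eval2 g P = 0"
proof
  fix P assume P: "P \<in> conchoid_points C A \<delta>"
  define B where "B = (\<Union>z\<in>F. {y \<in> C. \<exists>\<sigma>. \<sigma> \<noteq> 0 \<and> \<sigma>\<^sup>2 = N y \<and> dilate A (1 + \<delta> / \<sigma>) y = z})"
  have "finite B"
    unfolding B_def using assms(3) finite_conchoid_fibre[OF assms(1,2)] by (rule finite_UN_I)
  then have "infinite (C - B)" using infinite_zero_locus[OF irreducible_f] by simp
  then show "eval2 g P = 0"
  proof (rule vanishes_on_conchoid_points[OF _ _ _ P])
    fix y \<sigma> assume y: "y \<in> C - B" "\<sigma> \<noteq> 0" "\<sigma>\<^sup>2 = N y"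
    then have "y \<in> C" "y \<notin> B" by simp_all
    have "dilate A (1 + \<delta> / \<sigma>) y \<in> conchoid_points C A \<delta>"
      using \<open>y \<in> C\<close> y(2,3) by (rule conchoid_pointsI)
    moreover have "dilate A (1 + \<delta> / \<sigma>) y \<notin> F"
      using \<open>y \<in> C\<close> \<open>y \<notin> B\<close> y(2,3) by (auto simp: B_def)
    ultimately show "eval2 g (dilate A (1 + \<delta> / \<sigma>) y) = 0"
      using assms(4) by simp
  qed (rule Diff_subset)
qed

text \<open>
  The equation is the norm \<open>U\<^sup>2 - norm_sq (z - A) V\<^sup>2 = (U + w V) (U - w V)\<close> of the pulled back
  equation of \<open>C\<close>; the further factor \<open>norm_sq (z - A)\<close> takes care of the point \<open>A\<close>. The product
  is nonzero because on a horizontal line through \<open>A\<close> both factors are nonzero at all but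
  finitely many points.
\<close>
lemma conchoid_points_equation:
  obtains g where "g \<noteq> 0" "conchoid_points C A \<delta> \<subseteq> zero_locus {g}"
proof -
  obtain k U V where UV: "\<And>x \<sigma>. \<sigma> \<noteq> 0 \<Longrightarrow> \<sigma>\<^sup>2 = N x \<Longrightarrow>
      N x ^ k * eval2 f (dilate A (1 + - \<delta> / \<sigma>) x) = eval2 U x + \<sigma> * eval2 V x"
    by (rule eval2_dilate[of A f "- \<delta>"]) (erule that)
  define g where "g = norm_sq_poly A * (U\<^sup>2 - norm_sq_poly A * V\<^sup>2)"
  have g: "eval2 g z = N z * ((eval2 U z + w * eval2 V z) * (eval2 U z - w * eval2 V z))"
    if "w\<^sup>2 = N z" for z w
  proof -
    have "eval2 g z = N z * ((eval2 U z)\<^sup>2 - w\<^sup>2 * (eval2 V z)\<^sup>2)"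
      by (simp add: g_def that)
    then show ?thesis by (simp add: power2_eq_square algebra_simps)
  qed
  have "eval2 g z = 0" if z: "z \<in> conchoid_points C A \<delta>" for z
  proof (cases "N z = 0")
    case True
    then show ?thesis by (simp add: g_def)
  next
    case False
    obtain w where w: "w \<noteq> 0" "w\<^sup>2 = N z" "dilate A (1 + - \<delta> / w) z \<in> C"
      using conchoid_point_inverse[OF z False] by metis
    then have "eval2 U z + w * eval2 V z = 0" using UV[OF w(1,2)] by simp
    then show ?thesis unfolding g[OF w(2)] by simp
  qed
  then have "conchoid_points C A \<delta> \<subseteq> zero_locus {g}" by auto
  moreover have "g \<noteq> 0"
  proof -
    define F where "F = {c. A + scale c (1, 0) \<in> C}"
    have "finite F" unfolding F_def by (rule finite_on_line_param) (simp add: prod_eq_iff)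
    then have "finite (insert 0 ((\<lambda>c. c + \<delta>) ` F \<union> (\<lambda>c. c - \<delta>) ` F))" by simp
    from ex_new_if_finite[OF infinite_UNIV_char_0 this] obtain c where
      c: "c \<notin> insert 0 ((\<lambda>c. c + \<delta>) ` F \<union> (\<lambda>c. c - \<delta>) ` F)" by (rule exE)
    have "c = c - \<delta> + \<delta>" "c = c + \<delta> - \<delta>" by simp_all
    with c have c: "c \<noteq> 0" "c - \<delta> \<notin> F" "c + \<delta> \<notin> F" by blast+
    define z where "z = A + scale c (1, 0)"
    have N: "N z = c\<^sup>2" unfolding z_def norm_sq_ray by (simp add: norm_sq_def)
    have "(1 + - \<delta> / c) * c = c - \<delta>" "(1 + - \<delta> / (- c)) * c = c + \<delta>"
      using c(1) by (simp_all add: distrib_right left_diff_distrib)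
    then have "dilate A (1 + - \<delta> / c) z = A + scale (c - \<delta>) (1, 0)"
      "dilate A (1 + - \<delta> / (- c)) z = A + scale (c + \<delta>) (1, 0)"
      unfolding z_def dilate_ray by (simp_all only:)
    with c have "eval2 f (dilate A (1 + - \<delta> / c) z) \<noteq> 0" "eval2 f (dilate A (1 + - \<delta> / (- c)) z) \<noteq> 0"
      by (simp_all add: F_def)
    then have "eval2 U z + c * eval2 V z \<noteq> 0" "eval2 U z - c * eval2 V z \<noteq> 0"
      using UV[of c z] UV[of "- c" z] c(1) N by auto
    then have "eval2 g z \<noteq> 0" using c(1) N by (simp add: g[of c])
    then show ?thesis by auto
  qed
  ultimately show ?thesis by (rule that[rotated])
qed

lemma
  assumes "\<delta> \<noteq> 0" "C \<noteq> circle A \<delta>"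
  shows components_conchoid: "components (conchoid C A \<delta>) = curves_through (conchoid_points C A \<delta>)"
    and conchoid_points_cover: "conchoid_points C A \<delta> \<subseteq> \<Union>(curves_through (conchoid_points C A \<delta>))"
proof -
  obtain g where g: "g \<noteq> 0" "conchoid_points C A \<delta> \<subseteq> zero_locus {g}"
    by (rule conchoid_points_equation)
  show "components (conchoid C A \<delta>) = curves_through (conchoid_points C A \<delta>)"
    unfolding conchoid_eq_closure[OF assms(1)]
    by (rule components_zariski_closure[OF g conchoid_points_no_isolated[OF assms]])
  show "conchoid_points C A \<delta> \<subseteq> \<Union>(curves_through (conchoid_points C A \<delta>))"
    by (rule curves_through_cover[OF g conchoid_points_no_isolated[OF assms]])
qed

text \<open>
  If \<open>V\<close> vanishes on the conchoid, then so does \<open>U\<close>, and a conchoid point \<open>A + w e\<close> forces both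
  \<open>A + (w - \<delta>) e\<close> and \<open>A + (w + \<delta>) e\<close> to lie on \<open>C\<close>. Starting from one point of \<open>C\<close> this
  produces an arithmetic progression of points on a line through \<open>A\<close>, which is infinite in
  characteristic zero.
\<close>
lemma conchoid_sheet_distinguished:
  assumes "\<delta> \<noteq> 0"
    and UV: "\<And>x \<sigma>. \<sigma> \<noteq> 0 \<Longrightarrow> \<sigma>\<^sup>2 = N x \<Longrightarrow>
      N x ^ k * eval2 f (dilate A (1 + - \<delta> / \<sigma>) x) = eval2 U x + \<sigma> * eval2 V x"
  obtains z where "z \<in> conchoid_points C A \<delta>" "eval2 V z \<noteq> 0"
proof (rule ccontr)
  assume "\<not> thesis"
  with that have V0: "eval2 V z = 0" if "z \<in> conchoid_points C A \<delta>" for z using that by blast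
  have "infinite (C - {y \<in> C. N y = 0})"
    using infinite_zero_locus[OF irreducible_f] finite_isotropic by (rule Diff_infinite_finite[rotated])
  then have "C - {y \<in> C. N y = 0} \<noteq> {}" by (rule infinite_imp_nonempty)
  then obtain y where "y \<in> C - {y \<in> C. N y = 0}" by blast
  then have y: "y \<in> C" "N y \<noteq> 0" by auto
  obtain \<sigma> where \<sigma>: "\<sigma>\<^sup>2 = N y" using nth_root_exists[of 2 "N y"] by auto
  \<comment> \<open>The sign of the initial distance is chosen so that the progression avoids \<open>0\<close>, where no
    unit direction can be recovered.\<close>
  have "\<exists>\<tau>. \<tau>\<^sup>2 = N y \<and> (\<forall>j::nat. \<tau> + of_nat j * \<delta> \<noteq> 0)"
  proof (cases "\<forall>j::nat. \<sigma> + of_nat j * \<delta> \<noteq> 0")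
    case True
    with \<sigma> show ?thesis by (intro exI[of _ \<sigma>] conjI)
  next
    case False
    then obtain j0 :: nat where j0: "\<sigma> + of_nat j0 * \<delta> = 0" by auto
    have "- \<sigma> + of_nat j * \<delta> \<noteq> 0" for j :: nat
    proof
      assume "- \<sigma> + of_nat j * \<delta> = 0"
      with j0 have "(of_nat j0 + of_nat j) * \<delta> = 0" by (simp add: algebra_simps add_eq_0_iff2)
      then have "of_nat (j0 + j) = (0 :: 'k)" using assms(1) by simp
      then have "j0 = 0" by (simp only: of_nat_eq_0_iff add_is_0)
      with j0 have "\<sigma> = 0" by simp
      with \<sigma> y(2) show False by simp
    qed
    with \<sigma> show ?thesis by (intro exI[of _ "- \<sigma>"]) simp
  qed
  then obtain \<tau> where \<tau>: "\<tau>\<^sup>2 = N y" and avoid: "\<And>j::nat. \<tau> + of_nat j * \<delta> \<noteq> 0" by auto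
  have \<tau>0: "\<tau> \<noteq> 0" using avoid[of 0] by simp
  define e where "e = scale (1 / \<tau>) (y - A)"
  have y_eq: "y = A + scale \<tau> e" using \<tau>0 by (simp add: e_def scale_def prod_eq_iff)
  have norm_e: "norm_sq e = 1"
    using \<tau>0 y(2) unfolding e_def norm_sq_scale by (simp add: power_divide \<tau>)
  have ray: "A + scale (\<tau> + of_nat (2 * n) * \<delta>) e \<in> C" for n
  proof (induction n)
    case 0
    show ?case using y(1) by (simp add: y_eq)
  next
    case (Suc n)
    define r w where "r = \<tau> + of_nat (2 * n) * \<delta>" and "w = r + \<delta>"
    have "w = \<tau> + of_nat (2 * n + 1) * \<delta>" by (simp add: r_def w_def algebra_simps)
    then have nz: "r \<noteq> 0" "w \<noteq> 0" using avoid[of "2 * n"] avoid[of "2 * n + 1"] by (simp_all add: r_def)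
    define z where "z = A + scale w e"
    have IH: "A + scale r e \<in> C" unfolding r_def by (rule Suc.IH)
    have "r\<^sup>2 = N (A + scale r e)" unfolding norm_sq_ray norm_e by simp
    with IH nz(1) have "dilate A (1 + \<delta> / r) (A + scale r e) \<in> conchoid_points C A \<delta>"
      by (rule conchoid_pointsI)
    moreover have "(1 + \<delta> / r) * r = w" using nz(1) by (simp add: w_def distrib_right)
    then have "dilate A (1 + \<delta> / r) (A + scale r e) = z"
      unfolding dilate_ray z_def by (simp only:)
    ultimately have z: "z \<in> conchoid_points C A \<delta>" by (simp only:)
    have Nz: "w\<^sup>2 = N z" "(- w)\<^sup>2 = N z" unfolding z_def norm_sq_ray norm_e by simp_all
    have "(1 + - \<delta> / w) * w = w - \<delta>" using nz(2) by (simp add: left_diff_distrib)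
    then have "(1 + - \<delta> / w) * w = r" by (simp add: w_def)
    then have "dilate A (1 + - \<delta> / w) z = A + scale r e"
      unfolding z_def dilate_ray by (simp only:)
    with IH have "eval2 f (dilate A (1 + - \<delta> / w) z) = 0" by simp
    then have "eval2 U z = 0" using UV[OF nz(2) Nz(1)] V0[OF z] by simp
    then have "N z ^ k * eval2 f (dilate A (1 + - \<delta> / (- w)) z) = 0"
      using UV[OF _ Nz(2)] nz(2) V0[OF z] by simp
    moreover have "N z \<noteq> 0" using Nz(1) nz(2) by auto
    ultimately have "eval2 f (dilate A (1 + - \<delta> / (- w)) z) = 0" by simp
    moreover have "dilate A (1 + - \<delta> / (- w)) z = A + scale (\<tau> + of_nat (2 * Suc n) * \<delta>) e"
    proof -
      have "(1 + - \<delta> / (- w)) * w = \<tau> + of_nat (2 * Suc n) * \<delta>"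
        using nz(2) by (simp add: distrib_right) (simp add: w_def r_def algebra_simps)
      then show ?thesis unfolding z_def dilate_ray by (simp only:)
    qed
    ultimately show ?case by simp
  qed
  have "e \<noteq> 0" using norm_e by (auto simp: norm_sq_def)
  then have "finite {c. A + scale c e \<in> C}" by (rule finite_on_line_param)
  moreover have "range (\<lambda>n::nat. \<tau> + of_nat (2 * n) * \<delta>) \<subseteq> {c. A + scale c e \<in> C}"
    using ray by auto
  ultimately have "finite (range (\<lambda>n::nat. \<tau> + of_nat (2 * n) * \<delta>))" by (rule finite_subset[rotated])
  moreover have "inj (\<lambda>n::nat. \<tau> + of_nat (2 * n) * \<delta>)"
    using assms(1) by (intro injI) (simp del: of_nat_mult)
  ultimately show False using finite_imageD[of _ UNIV] by auto
qed

lemma finite_conchoid_points_on_line: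
  assumes "v \<noteq> 0"
  shows "finite (conchoid_points C A \<delta> \<inter> range (\<lambda>c. A + scale c v))"
proof -
  define L where "L = C \<inter> range (\<lambda>c. A + scale c v)"
  have "finite {\<sigma>. \<sigma>\<^sup>2 = N y}" for y
  proof -
    have "[:0, 1:]\<^sup>2 - [:N y:] \<noteq> 0" by (simp add: power2_eq_square)
    then have "finite {\<sigma>. poly ([:0, 1:]\<^sup>2 - [:N y:]) \<sigma> = 0}" by (rule poly_roots_finite)
    then show ?thesis by (simp add: poly_power)
  qed
  moreover have "finite L" unfolding L_def by (rule finite_on_line[OF assms])
  ultimately have "finite (insert A (\<Union>y\<in>L. (\<lambda>\<sigma>. dilate A (1 + \<delta> / \<sigma>) y) ` {\<sigma>. \<sigma>\<^sup>2 = N y}))"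
    by simp
  moreover have "conchoid_points C A \<delta> \<inter> range (\<lambda>c. A + scale c v) \<subseteq>
      insert A (\<Union>y\<in>L. (\<lambda>\<sigma>. dilate A (1 + \<delta> / \<sigma>) y) ` {\<sigma>. \<sigma>\<^sup>2 = N y})"
  proof
    fix z assume "z \<in> conchoid_points C A \<delta> \<inter> range (\<lambda>c. A + scale c v)"
    then have z: "z \<in> conchoid_points C A \<delta>" "z \<in> range (\<lambda>c. A + scale c v)" by simp_all
    obtain c where c: "z = A + scale c v" using z(2) by (rule rangeE)
    obtain y \<sigma> where y: "z = dilate A (1 + \<delta> / \<sigma>) y" "y \<in> C" "\<sigma> \<noteq> 0" "\<sigma>\<^sup>2 = N y"
      using z(1) by (rule conchoid_pointsE)
    show "z \<in> insert A (\<Union>y\<in>L. (\<lambda>\<sigma>. dilate A (1 + \<delta> / \<sigma>) y) ` {\<sigma>. \<sigma>\<^sup>2 = N y})"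
    proof (cases "\<sigma> + \<delta> = 0")
      case True
      then have "N z = 0" unfolding y(1) norm_sq_conchoid_point[OF y(3,4)] by simp
      then have "z = A" by (rule conchoid_point_isotropic[OF z(1)])
      then show ?thesis by simp
    next
      case False
      have "y = dilate A (1 + - \<delta> / (\<sigma> + \<delta>)) z"
        unfolding y(1) using conchoid_points_inverse[OF y(3) False] by simp
      then have "y = A + scale ((1 + - \<delta> / (\<sigma> + \<delta>)) * c) v" unfolding c dilate_ray .
      then have "y \<in> range (\<lambda>c. A + scale c v)" by (rule range_eqI)
      with y(2) have "y \<in> L" by (simp only: L_def Int_iff)
      then show ?thesis using y(1,4) by (intro insertI2 UN_I[of y] image_eqI[of _ _ \<sigma>]) simp_all
    qed
  qed
  ultimately show ?thesis by (rule finite_subset[rotated])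
qed

text \<open>
  These are the nonconstant rational maps into the double cover of \<open>C\<close> on which
  \<open>norm_sq (y - A)\<close> becomes a square.
\<close>
definition square_distance_map :: "('k \<Rightarrow> 'k \<times> 'k) \<Rightarrow> ('k \<Rightarrow> 'k) \<Rightarrow> bool" where
  "square_distance_map \<gamma> \<rho> \<longleftrightarrow> rational_map \<gamma> \<and> rational_fun \<rho> \<and>
     (\<forall>\<^sub>\<infinity>t. \<gamma> t \<in> C) \<and> (\<forall>\<^sub>\<infinity>t. (\<rho> t)\<^sup>2 = N (\<gamma> t))"

lemma square_distance_map_MOST:
  assumes "square_distance_map \<gamma> \<rho>"
  shows "\<forall>\<^sub>\<infinity>t. \<gamma> t \<in> C \<and> \<rho> t \<noteq> 0 \<and> (\<rho> t)\<^sup>2 = N (\<gamma> t)"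
proof -
  have \<gamma>: "rational_map \<gamma>" "\<forall>\<^sub>\<infinity>t. \<gamma> t \<in> C" "\<forall>\<^sub>\<infinity>t. (\<rho> t)\<^sup>2 = N (\<gamma> t)"
    using assms unfolding square_distance_map_def by simp_all
  show ?thesis
    using \<gamma>(2,3) rational_map_MOST_notin[OF \<gamma>(1) finite_isotropic]
    by eventually_elim auto
qed

text \<open>
  On the component \<open>h = 0\<close> the signed distance \<open>w = - U / V\<close> is a rational function of the
  point, so a parametrization \<open>\<gamma>\<close> of the component gives \<open>\<eta> = A + (1 - \<delta> / w) (\<gamma> - A)\<close> on \<open>C\<close>,
  with signed distance \<open>w - \<delta>\<close>. This map is not constant, since a line through \<open>A\<close> contains only
  finitely many of the conchoid points.
\<close>
lemma square_distance_map_from_component: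
  assumes UV: "\<And>x \<sigma>. \<sigma> \<noteq> 0 \<Longrightarrow> \<sigma>\<^sup>2 = N x \<Longrightarrow>
      N x ^ k * eval2 f (dilate A (1 + - \<delta> / \<sigma>) x) = eval2 U x + \<sigma> * eval2 V x"
    and h: "irreducible h" "infinite (conchoid_points C A \<delta> \<inter> zero_locus {h})" "\<not> h dvd V"
    and \<gamma>: "rational_map \<gamma>" "\<forall>\<^sub>\<infinity>t. eval2 h (\<gamma> t) = 0"
  obtains \<eta> \<rho> where "square_distance_map \<eta> \<rho>"
proof -
  let ?S = "conchoid_points C A \<delta>"
  define M where "M = ?S \<inter> zero_locus {h} - {A}"
  have M: "infinite M" using h(2) by (simp add: M_def)
  have M_h: "eval2 h z = 0" if "z \<in> M" for z using that by (simp add: M_def)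
  have M_inv: "\<exists>w. w \<noteq> 0 \<and> w \<noteq> \<delta> \<and> w\<^sup>2 = N z \<and> eval2 U z + w * eval2 V z = 0" if "z \<in> M" for z
  proof -
    have z: "z \<in> ?S" "z \<noteq> A" using that by (simp_all add: M_def)
    have "N z \<noteq> 0" using conchoid_point_isotropic[OF z(1)] z(2) by (rule contrapos_nn[rotated])
    from conchoid_point_inverse[OF z(1) this] obtain w where
      w: "w \<noteq> 0" "w \<noteq> \<delta>" "w\<^sup>2 = N z" "dilate A (1 + - \<delta> / w) z \<in> C" .
    have "eval2 U z + w * eval2 V z = 0" using UV[OF w(1,3)] w(4) by simp
    with w(1-3) show ?thesis by (intro exI conjI)
  qed
  have nN: "\<not> h dvd norm_sq_poly A"
  proof
    assume "h dvd norm_sq_poly A"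
    then have "N z = 0" if "z \<in> M" for z
      using eval2_eq_0_if_dvd[of h "norm_sq_poly A" z] M_h[OF that] by simp
    then have "M = {}" using M_inv by fastforce
    with M show False by simp
  qed
  have norm: "h dvd U\<^sup>2 - norm_sq_poly A * V\<^sup>2"
  proof (rule irreducible_dvd_if_infinite[OF h(1) M M_h])
    fix z assume "z \<in> M"
    then obtain w where w: "w\<^sup>2 = N z" "eval2 U z + w * eval2 V z = 0" using M_inv by blast
    have "eval2 U z = - (w * eval2 V z)" using w(2) by (simp add: eq_neg_iff_add_eq_0)
    then show "eval2 (U\<^sup>2 - norm_sq_poly A * V\<^sup>2) z = 0"
      by (simp add: power_mult_distrib w(1))
  qed
  \<comment> \<open>This excludes \<open>w = \<delta>\<close>, for which \<open>\<eta>\<close> would collapse to \<open>A\<close>.\<close>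
  have n\<delta>: "\<not> h dvd U + [:[:\<delta>:]:] * V"
  proof
    assume dvd: "h dvd U + [:[:\<delta>:]:] * V"
    have "eval2 V z = 0" if z: "z \<in> M" for z
    proof -
      obtain w where w: "w \<noteq> \<delta>" "eval2 U z + w * eval2 V z = 0" using M_inv[OF z] by blast
      have "eval2 U z + \<delta> * eval2 V z = 0"
        using eval2_eq_0_if_dvd[OF dvd M_h[OF z]] unfolding eval2_simps by simp
      with w(2) have "w * eval2 V z = \<delta> * eval2 V z" by (metis add_left_cancel)
      with w(1) show ?thesis by simp
    qed
    with irreducible_dvd_if_infinite[OF h(1) M M_h] h(3) show False by simp
  qed
  define w where "w = (\<lambda>t. 0 - eval2 U (\<gamma> t) / eval2 V (\<gamma> t))"
  define \<phi> where "\<phi> = (\<lambda>t. 1 + (0 - \<delta>) / w t)"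
  define \<eta> where "\<eta> = (\<lambda>t. dilate A (\<phi> t) (\<gamma> t))"
  define \<rho> where "\<rho> = (\<lambda>t. w t - \<delta>)"
  have good: "\<forall>\<^sub>\<infinity>t. eval2 h (\<gamma> t) = 0 \<and> N (\<gamma> t) \<noteq> 0 \<and> w t \<noteq> 0 \<and> w t \<noteq> \<delta> \<and> (w t)\<^sup>2 = N (\<gamma> t) \<and>
      eval2 U (\<gamma> t) + w t * eval2 V (\<gamma> t) = 0"
    using \<gamma>(2) rational_map_MOST_nonzero[OF \<gamma> h(1) h(3)]
      rational_map_MOST_nonzero[OF \<gamma> h(1) nN] rational_map_MOST_nonzero[OF \<gamma> h(1) n\<delta>]
  proof eventually_elim
    case (elim t)
    have w: "eval2 U (\<gamma> t) = - (w t * eval2 V (\<gamma> t))" using elim(2) by (simp add: w_def)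
    have "eval2 (U\<^sup>2 - norm_sq_poly A * V\<^sup>2) (\<gamma> t) = 0"
      by (rule eval2_eq_0_if_dvd[OF norm elim(1)])
    then have "((w t)\<^sup>2 - N (\<gamma> t)) * (eval2 V (\<gamma> t))\<^sup>2 = 0"
      by (simp add: w power_mult_distrib algebra_simps)
    then have sq: "(w t)\<^sup>2 = N (\<gamma> t)" using elim(2) by simp
    have "eval2 U (\<gamma> t) + \<delta> * eval2 V (\<gamma> t) \<noteq> 0" using elim(4) unfolding eval2_simps by simp
    then have "w t \<noteq> \<delta>" by (auto simp: w)
    moreover have "w t \<noteq> 0" using sq elim(3) by auto
    ultimately show ?case using sq elim(1,3) w by simp
  qed
  have "rational_fun (\<lambda>t. eval2 g (\<gamma> t))" for g
    using \<gamma>(1) unfolding rational_map_def by (intro rational_fun_eval2) simp_all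
  then have rw: "rational_fun w" unfolding w_def
    by (intro rational_fun_diff rational_fun_divide rational_fun_const)
  then have r\<phi>: "rational_fun \<phi>" unfolding \<phi>_def
    by (intro rational_fun_add rational_fun_divide rational_fun_const)
  have r\<rho>: "rational_fun \<rho>" unfolding \<rho>_def
    by (intro rational_fun_diff rational_fun_const rw)
  have on_C: "\<forall>\<^sub>\<infinity>t. \<eta> t \<in> C" using good
  proof eventually_elim
    case (elim t)
    have "N (\<gamma> t) ^ k * eval2 f (dilate A (1 + - \<delta> / w t) (\<gamma> t)) = 0"
      using UV[of "w t" "\<gamma> t"] elim by simp
    then show ?case using elim by (simp add: \<eta>_def \<phi>_def)
  qed
  have sq: "\<forall>\<^sub>\<infinity>t. (\<rho> t)\<^sup>2 = N (\<eta> t)" using good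
  proof eventually_elim
    case (elim t)
    have "\<phi> t * w t = \<rho> t" using elim by (simp add: \<phi>_def \<rho>_def left_diff_distrib)
    then have "(\<rho> t)\<^sup>2 = (\<phi> t)\<^sup>2 * (w t)\<^sup>2" by (simp add: power_mult_distrib flip: \<open>\<phi> t * w t = \<rho> t\<close>)
    then show ?case using elim unfolding \<eta>_def norm_sq_dilate by simp
  qed
  have fibres: "finite {t. \<eta> t = P}" for P
  proof -
    define L where "L = {z \<in> zero_locus {h}. P \<noteq> A \<and> z \<in> range (\<lambda>c. A + scale c (P - A))}"
    have "finite L"
    proof (cases "P = A")
      case False
      then have PA: "P - A \<noteq> 0" by simp
      have "\<not> h dvd line_poly A (P - A)"
      proof
        assume "h dvd line_poly A (P - A)"
        then have "z \<in> range (\<lambda>c. A + scale c (P - A))" if "eval2 h z = 0" for z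
          using eval2_eq_0_if_dvd[OF _ that] line_poly_eq_0_iff[OF PA] by blast
        then have "?S \<inter> zero_locus {h} \<subseteq> ?S \<inter> range (\<lambda>c. A + scale c (P - A))" by auto
        with h(2) finite_conchoid_points_on_line[OF PA] show False using finite_subset by blast
      qed
      from finite_common_zeros[OF h(1) this] show ?thesis
        by (rule finite_subset[rotated]) (auto simp: L_def line_poly_eq_0_iff[OF PA])
    qed (simp add: L_def)
    then have "\<forall>\<^sub>\<infinity>t. \<gamma> t \<notin> L" by (rule rational_map_MOST_notin[OF \<gamma>(1)])
    then have "\<forall>\<^sub>\<infinity>t. \<eta> t \<noteq> P" using good
    proof eventually_elim
      case (elim t)
      have \<phi>0: "\<phi> t \<noteq> 0" using elim by (simp add: \<phi>_def field_simps)
      show ?case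
      proof
        assume "\<eta> t = P"
        then have "\<gamma> t = dilate A (inverse (\<phi> t)) P" using \<phi>0 by (simp add: \<eta>_def flip: \<open>\<eta> t = P\<close>)
        then have ray: "\<gamma> t = A + scale (inverse (\<phi> t)) (P - A)" by (simp only: dilate_def)
        have "P \<noteq> A"
        proof
          assume "P = A"
          with ray have "\<gamma> t = A" by (simp add: scale_def prod_eq_iff)
          with elim show False by (simp add: norm_sq_def)
        qed
        moreover have "\<gamma> t \<in> range (\<lambda>c. A + scale c (P - A))" using ray by (rule range_eqI)
        ultimately show False using elim by (simp add: L_def)
      qed
    qed
    then show ?thesis by (simp add: MOST_iff_cofinite)
  qed
  have "rational_map \<eta>"
    unfolding rational_map_def \<eta>_def
    using rational_map_dilate[OF \<gamma>(1) r\<phi>] fibres unfolding \<eta>_def by (intro conjI allI)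
  with r\<rho> on_C sq have "square_distance_map \<eta> \<rho>" unfolding square_distance_map_def by (intro conjI)
  then show ?thesis by (rule that)
qed

lemma rational_curve_if_square_distance_map:
  assumes "square_distance_map \<gamma> \<rho>"
  shows "rational_curve C"
  using assms unfolding square_distance_map_def rational_curve_iff[OF irreducible_f] by auto

text \<open>
  The map need not be birational onto the component, but any nonconstant rational map into a
  curve makes it rational.
\<close>
lemma component_of_sheet:
  assumes "\<delta> \<noteq> 0" "C \<noteq> circle A \<delta>" "square_distance_map \<gamma> \<rho>"
  obtains h where "irreducible h" "rational_curve (zero_locus {h})"
    "\<forall>\<^sub>\<infinity>t. eval2 h (dilate A (1 + \<delta> / \<rho> t) (\<gamma> t)) = 0"
proof -
  define \<zeta> where "\<zeta> = (\<lambda>t. dilate A (1 + \<delta> / \<rho> t) (\<gamma> t))"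
  note good = square_distance_map_MOST[OF assms(3)]
  have \<gamma>: "rational_map \<gamma>" "rational_fun \<rho>"
    using assms(3) unfolding square_distance_map_def by simp_all
  have "finite {t. \<zeta> t = P}" for P
  proof -
    have "\<forall>\<^sub>\<infinity>t. \<zeta> t \<noteq> P"
      using good rational_map_MOST_notin[OF \<gamma>(1) finite_conchoid_fibre[OF assms(1,2), of P]]
      by eventually_elim (auto simp: \<zeta>_def)
    then show ?thesis by (simp add: MOST_iff_cofinite)
  qed
  moreover have r\<phi>: "rational_fun (\<lambda>t. 1 + \<delta> / \<rho> t)"
    by (intro rational_fun_add rational_fun_divide rational_fun_const \<gamma>(2))
  ultimately have \<zeta>: "rational_map \<zeta>"
    using rational_map_dilate[OF \<gamma>(1) r\<phi>] unfolding rational_map_def \<zeta>_def by (intro conjI allI)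
  obtain g where g: "g \<noteq> 0" "conchoid_points C A \<delta> \<subseteq> zero_locus {g}"
    by (rule conchoid_points_equation)
  obtain H where H: "finite H" "\<And>h. h \<in> H \<Longrightarrow> irreducible h"
    "zero_locus {g} \<subseteq> (\<Union>h\<in>H. zero_locus {h})"
    using irreducible_cover[OF g(1)] by blast
  have "\<forall>\<^sub>\<infinity>t. \<exists>h\<in>H. eval2 h (\<zeta> t) = 0" using good
  proof eventually_elim
    case (elim t)
    then have "\<zeta> t \<in> conchoid_points C A \<delta>" unfolding \<zeta>_def by (intro conchoid_pointsI) simp_all
    from subsetD[OF order_trans[OF g(2) H(3)] this] show ?case by simp
  qed
  then have "infinite {t. \<exists>h\<in>H. eval2 h (\<zeta> t) = 0}" by (rule infinite_if_MOST)
  moreover have "{t. \<exists>h\<in>H. eval2 h (\<zeta> t) = 0} = (\<Union>h\<in>H. {t. eval2 h (\<zeta> t) = 0})" by auto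
  ultimately obtain h where h: "h \<in> H" "infinite {t. eval2 h (\<zeta> t) = 0}"
    using H(1) by auto
  have "\<forall>\<^sub>\<infinity>t. eval2 h (\<zeta> t) = 0" by (rule rational_map_eval2[OF \<zeta> h(2)])
  moreover from this \<zeta> have "rational_curve (zero_locus {h})"
    unfolding rational_curve_iff[OF H(2)[OF h(1)]] by (intro exI conjI)
  ultimately show ?thesis using that[OF H(2)[OF h(1)]] unfolding \<zeta>_def by simp
qed

text \<open>
  The sheets belonging to \<open>\<rho>\<close> and \<open>- \<rho>\<close> give two rational components, possibly equal. Together
  they contain both conchoid points over infinitely many points of \<open>C\<close>, hence the whole
  conchoid.
\<close>
lemma rational_components_if_square_distance_map:
  assumes "\<delta> \<noteq> 0" "C \<noteq> circle A \<delta>" "square_distance_map \<gamma> \<rho>"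
    and "D \<in> components (conchoid C A \<delta>)"
  shows "rational_curve D"
proof -
  let ?S = "conchoid_points C A \<delta>"
  note good = square_distance_map_MOST[OF assms(3)]
  have neg: "square_distance_map \<gamma> (\<lambda>t. 0 - \<rho> t)"
    using assms(3) rational_fun_diff[OF rational_fun_const[of 0], of \<rho>]
    unfolding square_distance_map_def by simp
  obtain h1 where h1: "irreducible h1" "rational_curve (zero_locus {h1})"
    "\<forall>\<^sub>\<infinity>t. eval2 h1 (dilate A (1 + \<delta> / \<rho> t) (\<gamma> t)) = 0"
    by (rule component_of_sheet[OF assms(1-3)])
  obtain h2 where h2: "irreducible h2" "rational_curve (zero_locus {h2})"
    "\<forall>\<^sub>\<infinity>t. eval2 h2 (dilate A (1 + \<delta> / (0 - \<rho> t)) (\<gamma> t)) = 0"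
    by (rule component_of_sheet[OF assms(1,2) neg])
  define T where "T = {t. \<gamma> t \<in> C \<and> (\<rho> t)\<^sup>2 = N (\<gamma> t) \<and>
    eval2 h1 (dilate A (1 + \<delta> / \<rho> t) (\<gamma> t)) = 0 \<and> eval2 h2 (dilate A (1 + \<delta> / - \<rho> t) (\<gamma> t)) = 0}"
  have "\<forall>\<^sub>\<infinity>t. t \<in> T" using good h1(3) h2(3) by eventually_elim (simp add: T_def)
  then have "infinite {t. t \<in> T}" by (rule infinite_if_MOST)
  moreover have "finite {t. \<gamma> t = P}" for P
    using assms(3) unfolding square_distance_map_def rational_map_def by (elim conjE allE)
  ultimately have "infinite (\<gamma> ` T)"
    using infinite_image_finite_fibres[of \<gamma> T] by simp
  moreover have "\<gamma> ` T \<subseteq> C" by (auto simp: T_def)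
  ultimately have zero: "eval2 (h1 * h2) z = 0" if "z \<in> ?S" for z
  proof (rule vanishes_on_conchoid_points[OF _ _ _ that])
    fix y \<sigma> assume "y \<in> \<gamma> ` T" "\<sigma> \<noteq> 0" and \<sigma>: "\<sigma>\<^sup>2 = N y"
    then obtain t where t: "t \<in> T" "y = \<gamma> t" by (elim imageE)
    then have "\<sigma>\<^sup>2 = (\<rho> t)\<^sup>2" using \<sigma> by (simp add: T_def)
    then have "\<sigma> = \<rho> t \<or> \<sigma> = - \<rho> t" by (simp only: power2_eq_iff)
    then show "eval2 (h1 * h2) (dilate A (1 + \<delta> / \<sigma>) y) = 0" using t by (auto simp: T_def)
  qed
  obtain h where h: "D = zero_locus {h}" "irreducible h" "infinite (?S \<inter> zero_locus {h})"
    using assms(4) unfolding components_conchoid[OF assms(1,2)] curves_through_def by auto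
  have "?S \<inter> zero_locus {h} \<subseteq> (zero_locus {h} \<inter> zero_locus {h1}) \<union> (zero_locus {h} \<inter> zero_locus {h2})"
  proof
    fix z assume z: "z \<in> ?S \<inter> zero_locus {h}"
    then have "eval2 (h1 * h2) z = 0" by (intro zero) simp
    with z show "z \<in> (zero_locus {h} \<inter> zero_locus {h1}) \<union> (zero_locus {h} \<inter> zero_locus {h2})"
      by simp
  qed
  then have "infinite (zero_locus {h} \<inter> zero_locus {h1}) \<or> infinite (zero_locus {h} \<inter> zero_locus {h2})"
    using h(3) by (meson finite_Un finite_subset)
  then have "D = zero_locus {h1} \<or> D = zero_locus {h2}"
    using zero_locus_eqI[OF h(2) h1(1)] zero_locus_eqI[OF h(2) h2(1)] h(1) by auto
  then show ?thesis using h1(2) h2(2) by auto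
qed

lemma square_distance_map_if_rational_components:
  assumes "\<delta> \<noteq> 0" "C \<noteq> circle A \<delta>"
    and rational: "\<forall>D\<in>components (conchoid C A \<delta>). rational_curve D"
  obtains \<gamma> \<rho> where "square_distance_map \<gamma> \<rho>"
proof -
  let ?S = "conchoid_points C A \<delta>"
  obtain k U V where UV: "\<And>x \<sigma>. \<sigma> \<noteq> 0 \<Longrightarrow> \<sigma>\<^sup>2 = N x \<Longrightarrow>
      N x ^ k * eval2 f (dilate A (1 + - \<delta> / \<sigma>) x) = eval2 U x + \<sigma> * eval2 V x"
    by (rule eval2_dilate[of A f "- \<delta>"]) (erule that)
  obtain z where z: "z \<in> ?S" "eval2 V z \<noteq> 0"
    by (rule conchoid_sheet_distinguished[OF assms(1) UV])
  then obtain D where D: "D \<in> curves_through ?S" "z \<in> D"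
    using conchoid_points_cover[OF assms(1,2)] by (meson UnionE subsetD)
  then obtain h where h: "D = zero_locus {h}" "irreducible h" "infinite (?S \<inter> zero_locus {h})"
    unfolding curves_through_def by auto
  have "rational_curve D" using rational D(1) unfolding components_conchoid[OF assms(1,2)] by (rule bspec)
  then obtain \<gamma> where \<gamma>: "rational_map \<gamma>" "\<forall>\<^sub>\<infinity>t. eval2 h (\<gamma> t) = 0"
    unfolding h(1) rational_curve_iff[OF h(2)] by (elim exE conjE)
  have "\<not> h dvd V" using eval2_eq_0_if_dvd[of h V z] z(2) D(2) h(1) by auto
  from square_distance_map_from_component[OF UV h(2,3) this \<gamma>] that show ?thesis by metis
qed

end

theorem mainTheorem2:
  fixes C :: "('k::{alg_closed_field, field_char_0} \<times> 'k) set"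
    and a b d d' \<iota> :: 'k
  assumes "\<iota>\<^sup>2 = -1"
    and "d \<noteq> 0" and "d' \<noteq> 0"
    and "irreducible_plane_curve C"
    and "C \<noteq> {(y1, y2). y1 + \<iota> * y2 = 0}" and "C \<noteq> {(y1, y2). y1 - \<iota> * y2 = 0}"
    and "C \<noteq> circle (a, b) d" and "C \<noteq> circle (a, b) d'"
    and "\<not> (affine_line C \<and> (a, b) \<in> C)"
  shows "((\<forall>D\<in>components (conchoid C (a, b) d). rational_curve D) \<longrightarrow> rational_curve C) \<and>
         ((\<forall>D\<in>components (conchoid C (a, b) d). rational_curve D) \<longleftrightarrow>
          (\<forall>D\<in>components (conchoid C (a, b) d'). rational_curve D))"
proof -
  obtain f where f: "irreducible f" "C = zero_locus {f}"
    using assms(4) unfolding irreducible_plane_curve_def by (elim exE conjE)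
  interpret pointed_curve f "(a, b)" \<iota>
    by (rule pointed_curve.intro[OF f(1) assms(1) assms(9)[unfolded f(2)]])
  have iff: "(\<forall>D\<in>components (conchoid C (a, b) e). rational_curve D) \<longleftrightarrow>
      (\<exists>\<gamma> \<rho>. square_distance_map \<gamma> \<rho>)" if e: "e \<noteq> 0" "C \<noteq> circle (a, b) e" for e
  proof
    assume "\<forall>D\<in>components (conchoid C (a, b) e). rational_curve D"
    then obtain \<gamma> \<rho> where "square_distance_map \<gamma> \<rho>"
      by (rule square_distance_map_if_rational_components[OF e[unfolded f(2)], folded f(2)])
    then show "\<exists>\<gamma> \<rho>. square_distance_map \<gamma> \<rho>" by (intro exI)
  next
    assume "\<exists>\<gamma> \<rho>. square_distance_map \<gamma> \<rho>"
    then obtain \<gamma> \<rho> where "square_distance_map \<gamma> \<rho>" by (elim exE)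
    then show "\<forall>D\<in>components (conchoid C (a, b) e). rational_curve D"
      by (intro ballI rational_components_if_square_distance_map[OF e[unfolded f(2)], folded f(2)])
  qed
  have "rational_curve C" if "\<exists>\<gamma> \<rho>. square_distance_map \<gamma> \<rho>"
    using that rational_curve_if_square_distance_map unfolding f(2) by (elim exE)
  then show ?thesis
    unfolding iff[OF assms(2,7)] iff[OF assms(3,8)] by (intro conjI impI iffI)
qed

end
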